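(* Let $a\ge 2$ be a fixed integer and let $\{\psi_n\}_{n\ge 0}$ be the generalized Walsh system of order $a$. Then there exists a double series $$\sum_{n,k=1}^\infty c_{n,k}\psi_n(x)\psi_k(y)\qquad\text{with}\qquad \sum_{n,k=1}^\infty |c_{n,k}|^q<\infty\ \text{ for all } q>2,$$ with the following property: for every number $\varepsilon>0$ there exists a measurable weight function $\mu:T=[0,1]^2\to(0,1]$ satisfying $$0<\mu(x,y)\le 1,\qquad \bigl|\{(x,y)\in T:\ \mu(x,y)\neq 1\}\bigr|<\varepsilon,$$ such that the series is universal in $L^1_\mu(T)$ concerning subseries with respect to convergence in the sense of both spherical and rectangular partial sums.
   Context: Generalized Walsh system. Let $a\ge2$ be an integer and $\omega_a=e^{2\pi i/a}$. The Rademacher functions of order $a$ are defined by $\varphi_0(x)=\omega_a^k$ if $x\in[\frac ka,\frac{k+1}a)$, $k=0,1,\dots,a-1$, extended to $\mathbb R$ with period $1$, and $\varphi_n(x)=\varphi_0(a^nx)$ for $n\ge 0$. The generalized Walsh system of order $a$ is defined by $\psi_0(x)=1$ and, if $n=\alpha_1a^{n_1}+\dots+\alpha_sa^{n_s}$ with integers $n_1>\dots>n_s\ge 0$ and $\alpha_j\in\{1,\dots,a-1\}$ (the base-$a$ expansion of $n\ge1$), by $\psi_n(x)=\varphi_{n_1}(x)^{\alpha_1}\cdots\varphi_{n_s}(x)^{\alpha_s}$. The functions $\psi_n$ are in general complex valued, and coefficients are complex numbers. Notation. $T=[0,1]^2$ and $|\cdot|$ applied to sets denotes Lebesgue measure.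 For a measurable $\mu:T\to(0,1]$, $L^1_\mu(T)$ is the space of real measurable functions $f$ on $T$ with $\iint_T|f(x,y)|\mu(x,y)\,dx\,dy<\infty$; convergence to $f$ in $L^1_\mu(T)$ of (possibly complex-valued) functions $g_j$ means $\iint_T|g_j-f|\,\mu\,dx\,dy\to0$. Partial sums. For a double series $\sum_{k,\nu=1}^\infty d_{k,\nu}\psi_k(x)\psi_\nu(y)$ the rectangular partial sums are $S_{n,m}(x,y)=\sum_{k=1}^n\sum_{\nu=1}^m d_{k,\nu}\psi_k(x)\psi_\nu(y)$ and the spherical partial sums are $S_R(x,y)=\sum_{k,\nu\ge 1,\ k^2+\nu^2\le R^2}d_{k,\nu}\psi_k(x)\psi_\nu(y)$. Convergence in the sense of rectangular partial sums means convergence of $S_{n,m}$ as $\min\{n,m\}\to\infty$; convergence in the sense of spherical partial sums means convergence of $S_R$ as $R\to\infty$. Universality concerning subseries. The double series $\sum c_{n,k}\psi_n(x)\psi_k(y)$ is universal in $L^1_\mu(T)$ concerning subseries with respect to convergence in the sense of both spherical and rectangular partial sums if for every $f\in L^1_\mu(T)$ one can choose a subseries, i.e. a set $A$ of index pairs $(n,k)$, such that the double series with coefficients $d_{n,k}=c_{n,k}$ for $(n,k)\in A$ and $d_{n,k}=0$ otherwise converges to $f$ in $L^1_\mu(T)$ both in the sense of spherical partial sums and in the sense of rectangular partial sums. *)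

theory Defs
  imports "HOL-Analysis.Analysis"
begin

definition rademacher0 :: "nat \<Rightarrow> real \<Rightarrow> complex" where
  "rademacher0 a x = cis (2 * pi / real a) ^ nat \<lfloor>real a * frac x\<rfloor>"

definition rademacher :: "nat \<Rightarrow> nat \<Rightarrow> real \<Rightarrow> complex" where
  "rademacher a n x = rademacher0 a (real a ^ n * x)"

definition digit :: "nat \<Rightarrow> nat \<Rightarrow> nat \<Rightarrow> nat" where
  "digit a n j = (n div a ^ j) mod a"

text \<open>The product runs over the positions of the nonzero base-\<open>a\<close> digits of \<open>n\<close>, a finite set for
  \<open>a \<ge> 2\<close>; see \<open>walsh_0\<close> and \<open>walsh_expansion\<close> below for the textbook form.\<close>

definition walsh :: "nat \<Rightarrow> nat \<Rightarrow> real \<Rightarrow> complex" where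
  "walsh a n x = (\<Prod>j \<in> {j. digit a n j \<noteq> 0}. rademacher a j x ^ digit a n j)"

lemma rademacher0_interval:
  assumes "k < a" "real k / real a \<le> x" "x < (real k + 1) / real a"
  shows "rademacher0 a x = cis (2 * pi / real a) ^ k"
proof -
  have a: "real a > 0" using assms(1) by simp
  have k: "real k + 1 \<le> real a" using assms(1) by linarith
  have "x \<ge> 0" using assms(2) a by (meson divide_nonneg_nonneg of_nat_0_le_iff order_trans)
  moreover have "(real k + 1) / real a \<le> 1" using a k by simp
  ultimately have "frac x = x" using assms(3) by (simp add: frac_eq)
  moreover have "\<lfloor>real a * x\<rfloor> = int k"
    using assms(2,3) a by (intro floor_unique) (auto simp: field_simps)
  ultimately show ?thesis by (simp add: rademacher0_def)
qed

lemma rademacher0_periodic: "rademacher0 a (x + 1) = rademacher0 a x"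
  by (simp add: rademacher0_def frac_1_eq)

lemma digit_sum:
  assumes "a \<ge> 2" "\<And>j. \<beta> j < a"
  shows "digit a (\<Sum>j<N. \<beta> j * a ^ j) i = (if i < N then \<beta> i else 0)"
  using assms(2)
proof (induction i arbitrary: N \<beta>)
  case 0
  show ?case
  proof (cases N)
    case 0
    then show ?thesis by (simp add: digit_def)
  next
    case (Suc M)
    have "(\<Sum>j<N. \<beta> j * a ^ j) = \<beta> 0 + a * (\<Sum>j<M. \<beta> (Suc j) * a ^ j)"
      unfolding Suc sum.lessThan_Suc_shift by (simp add: sum_distrib_left mult_ac)
    then show ?thesis using 0 Suc by (simp add: digit_def)
  qed
next
  case (Suc i)
  show ?case
  proof (cases N)
    case 0
    then show ?thesis by (simp add: digit_def)
  next
    case N: (Suc M)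
    have "(\<Sum>j<N. \<beta> j * a ^ j) = \<beta> 0 + a * (\<Sum>j<M. \<beta> (Suc j) * a ^ j)"
      unfolding N sum.lessThan_Suc_shift by (simp add: sum_distrib_left mult_ac)
    then have "(\<Sum>j<N. \<beta> j * a ^ j) div a = (\<Sum>j<M. \<beta> (Suc j) * a ^ j)"
      using Suc.prems[of 0] assms(1) by simp
    then have "digit a (\<Sum>j<N. \<beta> j * a ^ j) (Suc i) = digit a (\<Sum>j<M. \<beta> (Suc j) * a ^ j) i"
      by (simp add: digit_def div_mult2_eq)
    then show ?thesis using Suc.IH[of "\<lambda>j. \<beta> (Suc j)" M] Suc.prems N by simp
  qed
qed

lemma walsh_0: "walsh a 0 x = 1"
  by (simp add: walsh_def digit_def)

lemma walsh_expansion: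
  assumes "a \<ge> 2" "finite J" "\<And>j. j \<in> J \<Longrightarrow> 1 \<le> \<alpha> j \<and> \<alpha> j \<le> a - 1"
    and "n = (\<Sum>j\<in>J. \<alpha> j * a ^ j)"
  shows "walsh a n x = (\<Prod>j\<in>J. rademacher a j x ^ \<alpha> j)"
proof -
  define \<beta> where "\<beta> j = (if j \<in> J then \<alpha> j else 0)" for j
  obtain N where N: "J \<subseteq> {..<N}"
    using assms(2) finite_nat_iff_bounded by blast
  have "n = (\<Sum>j<N. \<beta> j * a ^ j)"
    unfolding assms(4) using N by (intro sum.mono_neutral_cong_left) (auto simp: \<beta>_def)
  moreover have "\<beta> j < a" for j
    using assms(1) assms(3)[of j] by (auto simp: \<beta>_def)
  ultimately have d: "digit a n j = \<beta> j" for j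
    using digit_sum[OF assms(1), of \<beta> N j] N by (auto simp: \<beta>_def)
  have "{j. digit a n j \<noteq> 0} = J"
    using assms(3) by (force simp: d \<beta>_def)
  then show ?thesis
    by (simp add: walsh_def d \<beta>_def)
qed

abbreviation unit_square :: "(real \<times> real) set" where
  "unit_square \<equiv> {0..1} \<times> {0..1}"

definition L1_space :: "(real \<times> real \<Rightarrow> real) \<Rightarrow> (real \<times> real \<Rightarrow> real) set" where
  "L1_space \<mu> = {f \<in> borel_measurable (lebesgue_on unit_square).
     (\<integral>\<^sup>+z. ennreal (\<bar>f z\<bar> * \<mu> z) \<partial>lebesgue_on unit_square) < \<infinity>}"

definition L1_converges ::
  "(real \<times> real \<Rightarrow> real) \<Rightarrow> ('i \<Rightarrow> real \<times> real \<Rightarrow> complex) \<Rightarrow> (real \<times> real \<Rightarrow> real) \<Rightarrow> 'i filter \<Rightarrow> bool"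
  where
  "L1_converges \<mu> g f F \<longleftrightarrow>
     ((\<lambda>j. \<integral>\<^sup>+z. ennreal (norm (g j z - complex_of_real (f z)) * \<mu> z) \<partial>lebesgue_on unit_square) \<longlongrightarrow> 0) F"

text \<open>Coefficients are indexed by pairs of natural numbers; only the values at indices \<open>\<ge> 1\<close> are used.\<close>

definition rect_sum :: "nat \<Rightarrow> (nat \<Rightarrow> nat \<Rightarrow> complex) \<Rightarrow> nat \<times> nat \<Rightarrow> real \<times> real \<Rightarrow> complex" where
  "rect_sum a d = (\<lambda>(n, m) (x, y). \<Sum>k=1..n. \<Sum>\<nu>=1..m. d k \<nu> * walsh a k x * walsh a \<nu> y)"

definition sph_index :: "real \<Rightarrow> (nat \<times> nat) set" where
  "sph_index R = {(k, \<nu>). k \<ge> 1 \<and> \<nu> \<ge> 1 \<and> (real k)\<^sup>2 + (real \<nu>)\<^sup>2 \<le> R\<^sup>2}"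

lemma finite_sph_index: "finite (sph_index R)"
proof (rule finite_subset)
  have "k \<le> nat \<lceil>\<bar>R\<bar>\<rceil>" if "(real k)\<^sup>2 \<le> R\<^sup>2" for k :: nat
  proof -
    have "real k \<le> \<bar>R\<bar>" using that by (simp add: abs_le_square_iff[symmetric])
    then show ?thesis by linarith
  qed
  moreover have "(real k)\<^sup>2 \<le> R\<^sup>2 \<and> (real \<nu>)\<^sup>2 \<le> R\<^sup>2" if "(real k)\<^sup>2 + (real \<nu>)\<^sup>2 \<le> R\<^sup>2" for k \<nu> :: nat
    using that zero_le_power2[of "real k"] zero_le_power2[of "real \<nu>"] by linarith
  ultimately show "sph_index R \<subseteq> {..nat \<lceil>\<bar>R\<bar>\<rceil>} \<times> {..nat \<lceil>\<bar>R\<bar>\<rceil>}"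
    unfolding sph_index_def by blast
qed simp

definition sph_sum :: "nat \<Rightarrow> (nat \<Rightarrow> nat \<Rightarrow> complex) \<Rightarrow> real \<Rightarrow> real \<times> real \<Rightarrow> complex" where
  "sph_sum a d R = (\<lambda>(x, y). \<Sum>(k, \<nu>) \<in> sph_index R. d k \<nu> * walsh a k x * walsh a \<nu> y)"

definition subseries :: "(nat \<times> nat) set \<Rightarrow> (nat \<Rightarrow> nat \<Rightarrow> complex) \<Rightarrow> nat \<Rightarrow> nat \<Rightarrow> complex" where
  "subseries A c n k = (if (n, k) \<in> A then c n k else 0)"

text \<open>Convergence along \<open>sequentially \<times>\<^sub>F sequentially\<close> is convergence as \<open>min n m \<rightarrow> \<infinity>\<close>.\<close>

definition universal_subseries ::
  "nat \<Rightarrow> (real \<times> real \<Rightarrow> real) \<Rightarrow> (nat \<Rightarrow> nat \<Rightarrow> complex) \<Rightarrow> bool" where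
  "universal_subseries a \<mu> c \<longleftrightarrow>
     (\<forall>f \<in> L1_space \<mu>. \<exists>A \<subseteq> {1..} \<times> {1..}.
        L1_converges \<mu> (sph_sum a (subseries A c)) f at_top \<and>
        L1_converges \<mu> (rect_sum a (subseries A c)) f (sequentially \<times>\<^sub>F sequentially))"

end

theory Submission
  imports Defs
begin

text \<open>
  The series is built from blocks. A block is a Walsh polynomial
  \<open>Q(x,y) = \<gamma> \<chi>(x) h(a\<^sup>n x) \<chi>'(y) h(a\<^sup>n y)\<close>, where \<open>\<chi>\<close> and \<open>\<chi>'\<close> are indicators of \<open>a\<close>-adic intervals of
  rank \<open>r \<le> n\<close>, and where the function \<open>h\<close> of period 1 equals \<open>1 - a\<^sup>p\<close> on an interval of length \<open>a\<^sup>-\<^sup>p\<close> and 1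
  elsewhere. As \<open>h\<close> has mean zero, the frequencies of \<open>Q\<close> in both variables lie between
  \<open>a\<^sup>n\<close> and \<open>a\<^sup>n\<^sup>+\<^sup>p\<close>. Outside a bad set of measure at most \<open>2 a\<^sup>-\<^sup>2\<^sup>r\<^sup>-\<^sup>p\<close> the block coincides with the step
  function \<open>\<gamma> \<chi>(x) \<chi>'(y)\<close>. Its nonzero coefficients have modulus \<open>|\<gamma>| a\<^sup>-\<^sup>2\<^sup>r\<close>, and its norm in \<open>L\<^sup>2\<close> is at
  most \<open>|\<gamma>| a\<^sup>p\<^sup>-\<^sup>r\<close>. By orthogonality the latter number bounds the \<open>L\<^sup>1\<close> norm of all partial sums of the
  block, for index sets of any shape (\<open>nn_integral_partial_block_le\<close>).

  At stage \<open>s\<close> the series contains one block for each square of rank \<open>r = s\<^sup>2\<close> and each \<open>\<gamma>\<close> in a net of mesh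
  \<open>a\<^sup>-\<^sup>s\<close> in \<open>[-a\<^sup>s, a\<^sup>s]\<close>, with \<open>p = 3s\<close>. Then the bad sets have summable measure, the coefficients have
  summable \<open>q\<close>-th powers for every \<open>q > 2\<close>, and the bound for the partial sums of a single block tends to zero.
  The frequency squares of the blocks are placed one after the other along the diagonal. Hence a
  rectangle or a disc contains all blocks before some index and meets no block after it, and a
  partial sum of a subseries made of whole blocks is a sum of complete blocks plus a partial sum of
  one block, which is negligible (\<open>walsh_poly_subseries\<close>, \<open>subseries_converges\<close>).

  The weight is \<open>1 / (1 + \<Sum> K\<^sub>l 1\<^bsub>B(l)\<^esub>)\<close>, summed over the bad sets \<open>B(l)\<close> with \<open>l \<ge> l\<^sub>0\<close>. It
  differs from 1 only on these sets, whose total measure is small for large \<open>l\<^sub>0\<close>; and if the \<open>K\<^sub>l\<close> are large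
  enough, then block and step function differ by at most \<open>2\<^sup>-\<^sup>l\<close> in the weighted norm. So, for any
  function of the weighted space, a continuous function close to it is close to a sum of step functions of one late
  stage, one for each square, and hence to the sum of the corresponding blocks; as the steps have
  disjoint supports, no partial sum of this sum is essentially larger than the function itself
  (\<open>weighted_approximation\<close>). Approximating the remainders in turn yields the subseries
  (\<open>greedy_selection\<close>).
\<close>

section \<open>The generalized Walsh system as a system of characters\<close>

lemma sum_split_base:
  fixes f :: "nat \<Rightarrow> 'b :: comm_monoid_add"
  assumes "b > 0"
  shows "(\<Sum>k<b * M. f k) = (\<Sum>m<M. \<Sum>k<b. f (k + m * b))"
proof (induction M)
  case (Suc M)
  have "(\<Sum>k<b * Suc M. f k) = (\<Sum>k<b * M. f k) + (\<Sum>k=b*M..<b * Suc M. f k)"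
    by (subst sum.atLeastLessThan_concat[of 0 "b*M" "b * Suc M" f, symmetric, unfolded lessThan_atLeast0[symmetric]]) auto
  also have "(\<Sum>k=b*M..<b * Suc M. f k) = (\<Sum>k<b. f (k + M * b))"
    using sum.shift_bounds_nat_ivl[of f 0 "b * M" b] by (simp add: lessThan_atLeast0 add.commute mult.commute)
  finally show ?case using Suc by simp
qed simp

locale adic_base =
  fixes a :: nat
  assumes base_ge_2: "a \<ge> 2"
begin

text \<open>Orthogonality of the characters of the cyclic group of order \<open>a\<close>. It serves twice: summed over
exponents in \<open>walsh_kernel_unit\<close>, summed over digits in \<open>walsh_orthogonal\<close>.\<close>

lemma root_of_unity_sum:
  assumes "d < a" "e < a"
  shows "(\<Sum>j<a. (cis (2 * pi / real a) ^ d * cnj (cis (2 * pi / real a) ^ e)) ^ j)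
    = (if d = e then of_nat a else 0)"
proof -
  let ?w = "cis (2 * pi / real a)"
  let ?z = "?w ^ d * cnj (?w ^ e)"
  have pw: "?w ^ n = cis (2 * pi * real n / real a)" for n
    using Complex.DeMoivre[of "2 * pi / real a" n] by (simp add: mult_ac)
  have unit: "cnj (?w ^ e) * ?w ^ e = 1"
    by (simp add: pw cis_cnj cis_mult)
  have za: "?z ^ a = 1"
  proof -
    have "?w ^ a = 1" using base_ge_2 by (simp add: pw)
    then have "(?w ^ m) ^ a = 1" for m
      by (metis power_mult mult.commute power_one)
    then show ?thesis
      by (simp add: power_mult_distrib flip: complex_cnj_power)
  qed
  show ?thesis
  proof (cases "d = e")
    case True
    then have "?z = 1" using unit by (simp add: mult.commute)
    with True show ?thesis by simp
  next
    case False
    have "?z \<noteq> 1"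
    proof
      assume "?z = 1"
      then have "?w ^ d = ?w ^ e" using unit by (metis mult.assoc mult.left_neutral mult.right_neutral)
      moreover have "inj_on (\<lambda>k. cis (2 * pi * real k / real a)) {..<a}"
        using Complex.bij_betw_roots_unity[of a] base_ge_2 by (auto simp: bij_betw_def)
      ultimately show False using False assms by (auto simp: pw inj_on_def)
    qed
    then show ?thesis using False za by (simp add: sum_gp_strict)
  qed
qed

definition adic_digit :: "nat \<Rightarrow> real \<Rightarrow> nat" where
  "adic_digit j x = nat \<lfloor>real a * frac (real a ^ j * x)\<rfloor>"

lemma rademacher_digit: "rademacher a j x = cis (2 * pi / real a) ^ adic_digit j x"
  by (simp add: rademacher_def rademacher0_def adic_digit_def)

lemma adic_digit_less: "adic_digit j x < a"
proof -
  have "real a * frac (real a ^ j * x) < real a"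
    using frac_lt_1[of "real a ^ j * x"] base_ge_2 by simp
  then have "\<lfloor>real a * frac (real a ^ j * x)\<rfloor> < int a" by linarith
  then show ?thesis using base_ge_2 by (auto simp: adic_digit_def)
qed

lemma rademacher_shift: "rademacher a j (real a ^ n * x) = rademacher a (j + n) x"
  by (simp add: rademacher_def power_add mult_ac)

lemma rademacher_Ints_shift: "k \<in> \<int> \<Longrightarrow> rademacher a j (k + x) = rademacher a j x"
proof -
  assume k: "k \<in> \<int>"
  have "frac (real a ^ j * (k + x)) = frac (real a ^ j * x)"
  proof -
    have "real a ^ j * k \<in> \<int>" using k by simp
    then obtain i where i: "real a ^ j * k = of_int i" by (auto elim: Ints_cases)
    have "frac (of_int i + real a ^ j * x) = frac (real a ^ j * x)" by (simp add: frac_def)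
    then show ?thesis using i by (simp add: distrib_left)
  qed
  then show ?thesis by (simp add: rademacher_digit adic_digit_def)
qed

lemma norm_rademacher [simp]: "norm (rademacher a j x) = 1"
  by (simp add: rademacher_digit norm_power)

lemma digit_eq_0: "n < a ^ N \<Longrightarrow> j \<ge> N \<Longrightarrow> digit a n j = 0"
proof -
  assume *: "n < a ^ N" "j \<ge> N"
  have "a ^ N \<le> a ^ j" using * base_ge_2 by (intro power_increasing) auto
  with * show ?thesis by (simp add: digit_def)
qed

lemma walsh_lessThan:
  assumes "n < a ^ N"
  shows "walsh a n x = (\<Prod>j<N. rademacher a j x ^ digit a n j)"
  unfolding walsh_def
proof (rule prod.mono_neutral_left)
  show "{j. digit a n j \<noteq> 0} \<subseteq> {..<N}"
    using digit_eq_0[OF assms] by (force simp: not_less[symmetric])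
qed auto

lemma less_power_self: "n < a ^ n"
  using base_ge_2 by (metis One_nat_def Suc_1 Suc_le_lessD less_exp order_less_le_trans power_mono zero_le)

lemma norm_walsh [simp]: "norm (walsh a n x) = 1"
  by (simp add: walsh_def norm_power prod_norm[symmetric])

lemma walsh_Ints_shift: "k \<in> \<int> \<Longrightarrow> walsh a n (k + x) = walsh a n x"
  by (simp add: walsh_def rademacher_Ints_shift)

lemma walsh_frac: "walsh a n (frac x) = walsh a n x"
  using walsh_Ints_shift[of "of_int \<lfloor>x\<rfloor>" n "frac x"] by (simp add: frac_def)

text \<open>The digits of the index below and above position \<open>n\<close> contribute independent factors, and the
upper ones see the argument rescaled by \<open>a\<^sup>n\<close>.\<close>

lemma walsh_split:
  assumes "k < a ^ n"
  shows "walsh a (k + m * a ^ n) x = walsh a k x * walsh a m (real a ^ n * x)"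
proof -
  have m: "m < a ^ m" by (rule less_power_self)
  have "k + m * a ^ n < (m + 1) * a ^ n" using assms by simp
  also have "\<dots> \<le> a ^ m * a ^ n" using m by (intro mult_right_mono) auto
  finally have less: "k + m * a ^ n < a ^ (m + n)" unfolding power_add .
  have low: "digit a (k + m * a ^ n) j = digit a k j" if "j < n" for j
  proof -
    obtain d where d: "n = j + Suc d" using less_imp_Suc_add[OF \<open>j < n\<close>] by auto
    have "k + m * a ^ n = k + (m * a ^ d * a) * a ^ j"
      by (simp add: d power_add mult_ac)
    moreover have "(k + (m * a ^ d * a) * a ^ j) div a ^ j = m * a ^ d * a + k div a ^ j"
      using base_ge_2 by (intro div_mult_self1) simp
    ultimately have "(k + m * a ^ n) div a ^ j = m * a ^ d * a + k div a ^ j"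
      by (simp only:)
    then show ?thesis by (simp add: digit_def)
  qed
  have high: "digit a (k + m * a ^ n) (j + n) = digit a m j" for j
  proof -
    have "(k + m * a ^ n) div a ^ n = m"
      using assms base_ge_2 by (subst div_mult_self1) simp_all
    then show ?thesis by (simp only: digit_def add.commute[of j n] power_add div_mult2_eq)
  qed
  have "walsh a (k + m * a ^ n) x =
      (\<Prod>j<m + n. rademacher a j x ^ digit a (k + m * a ^ n) j)"
    by (rule walsh_lessThan[OF less])
  also have "\<dots> = (\<Prod>j<n. rademacher a j x ^ digit a k j) *
      (\<Prod>j<m. rademacher a (j + n) x ^ digit a m j)"
    using prod.atLeastLessThan_concat[of 0 n "m + n" "\<lambda>j. rademacher a j x ^ digit a (k + m * a ^ n) j"]
      prod.shift_bounds_nat_ivl[of "\<lambda>j. rademacher a j x ^ digit a (k + m * a ^ n) j" 0 n m]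
    by (simp add: lessThan_atLeast0 low high)
  also have "\<dots> = walsh a k x * walsh a m (real a ^ n * x)"
    using assms m by (simp add: walsh_lessThan rademacher_shift)
  finally show ?thesis .
qed

lemma walsh_less_base: "\<alpha> < a \<Longrightarrow> walsh a \<alpha> x = rademacher a 0 x ^ \<alpha>"
  by (subst walsh_lessThan[of _ 1]) (auto simp: digit_def)

lemma floor_power_Suc:
  assumes "x \<ge> 0"
  shows "nat \<lfloor>real a ^ Suc n * x\<rfloor> = a * nat \<lfloor>real a ^ n * x\<rfloor> + adic_digit n x"
proof -
  let ?y = "real a ^ n * x"
  have "real a ^ Suc n * x = of_int (int a * \<lfloor>?y\<rfloor>) + real a * frac ?y"
    by (simp add: frac_def algebra_simps)
  then have "\<lfloor>real a ^ Suc n * x\<rfloor> = int a * \<lfloor>?y\<rfloor> + \<lfloor>real a * frac ?y\<rfloor>"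
    by (metis floor_add_int add.commute)
  moreover have "\<lfloor>?y\<rfloor> \<ge> 0" "\<lfloor>real a * frac ?y\<rfloor> \<ge> 0" using assms by auto
  ultimately show ?thesis by (simp add: adic_digit_def nat_add_distrib nat_mult_distrib)
qed

text \<open>The Dirichlet kernel of order \<open>a\<^sup>n\<close> is a product over digit positions of character sums, each of which
vanishes unless \<open>x\<close> and \<open>y\<close> have the same digit there.\<close>

lemma walsh_kernel_unit:
  assumes "0 \<le> x" "x < 1" "0 \<le> y" "y < 1"
  shows "(\<Sum>k<a ^ n. walsh a k x * cnj (walsh a k y)) =
    (if nat \<lfloor>real a ^ n * x\<rfloor> = nat \<lfloor>real a ^ n * y\<rfloor> then of_nat (a ^ n) else 0)"
proof (induction n)
  case 0
  then show ?case using assms by (simp add: walsh_0 floor_eq_iff)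
next
  case (Suc n)
  have "(\<Sum>k<a ^ Suc n. walsh a k x * cnj (walsh a k y)) =
    (\<Sum>m<a. \<Sum>k<a ^ n. walsh a (k + m * a ^ n) x * cnj (walsh a (k + m * a ^ n) y))"
    using base_ge_2 sum_split_base[of "a ^ n" "\<lambda>k. walsh a k x * cnj (walsh a k y)" a] by (simp add: mult.commute)
  also have "\<dots> = (\<Sum>m<a. \<Sum>k<a ^ n. walsh a k x * cnj (walsh a k y) *
       (rademacher a n x * cnj (rademacher a n y)) ^ m)"
    by (intro sum.cong refl)
      (simp add: walsh_split walsh_less_base rademacher_shift power_mult_distrib)
  also have "\<dots> = (\<Sum>k<a ^ n. walsh a k x * cnj (walsh a k y)) *
       (\<Sum>m<a. (rademacher a n x * cnj (rademacher a n y)) ^ m)"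
    by (simp add: sum_distrib_left sum_distrib_right)
  also have "(\<Sum>m<a. (rademacher a n x * cnj (rademacher a n y)) ^ m) =
     (if adic_digit n x = adic_digit n y then of_nat a else 0)"
    unfolding rademacher_digit by (rule root_of_unity_sum) (auto simp: adic_digit_less)
  finally have sum: "(\<Sum>k<a ^ Suc n. walsh a k x * cnj (walsh a k y)) =
     (\<Sum>k<a ^ n. walsh a k x * cnj (walsh a k y)) *
     (if adic_digit n x = adic_digit n y then of_nat a else 0)" .
  have "(a * nat \<lfloor>real a ^ n * x\<rfloor> + adic_digit n x = a * nat \<lfloor>real a ^ n * y\<rfloor> + adic_digit n y)
     \<longleftrightarrow> nat \<lfloor>real a ^ n * x\<rfloor> = nat \<lfloor>real a ^ n * y\<rfloor> \<and> adic_digit n x = adic_digit n y"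
    using adic_digit_less[of n x] adic_digit_less[of n y]
  proof -
    have "(a * q + d) div a = q" "(a * q + d) mod a = d" if "d < a" for q d
      using that by simp_all
    with adic_digit_less[of n x] adic_digit_less[of n y] show ?thesis by metis
  qed
  then have "(nat \<lfloor>real a ^ Suc n * x\<rfloor> = nat \<lfloor>real a ^ Suc n * y\<rfloor>)
     \<longleftrightarrow> nat \<lfloor>real a ^ n * x\<rfloor> = nat \<lfloor>real a ^ n * y\<rfloor> \<and> adic_digit n x = adic_digit n y"
    by (simp only: floor_power_Suc[OF assms(1)] floor_power_Suc[OF assms(3)])
  moreover have "of_nat (a ^ n) * of_nat a = (of_nat (a ^ Suc n) :: complex)"
    by (simp add: mult.commute)
  ultimately show ?case
    unfolding sum Suc
    by (cases "nat \<lfloor>real a ^ n * x\<rfloor> = nat \<lfloor>real a ^ n * y\<rfloor>"; cases "adic_digit n x = adic_digit n y")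
      (simp_all only: simp_thms if_True if_False mult_zero_left mult_zero_right)
qed

text \<open>The number of the \<open>a\<close>-adic interval of rank \<open>r\<close> that contains \<open>x\<close> modulo 1. Taking the fractional
part makes the identities below hold on the whole line; the point 1 counts as 0.\<close>

definition cell :: "nat \<Rightarrow> real \<Rightarrow> nat" where
  "cell r x = nat \<lfloor>real a ^ r * frac x\<rfloor>"

lemma walsh_kernel:
  "(\<Sum>k<a ^ n. walsh a k x * cnj (walsh a k y)) = (if cell n x = cell n y then of_nat (a ^ n) else 0)"
  using walsh_kernel_unit[of "frac x" "frac y" n]
  by (simp add: walsh_frac cell_def frac_lt_1)

lemma cell_grid_point: "i < a ^ r \<Longrightarrow> cell r (real i / real a ^ r) = i"
proof -
  assume "i < a ^ r"
  then have "real i < real a ^ r" by (metis of_nat_less_iff of_nat_power)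
  then have "frac (real i / real a ^ r) = real i / real a ^ r"
    using base_ge_2 by (simp add: frac_eq)
  then show ?thesis using base_ge_2 by (simp add: cell_def)
qed

lemma cell_less: "cell r x < a ^ r"
proof -
  have "real a ^ r * frac x < real a ^ r"
    using frac_lt_1[of x] base_ge_2 by simp
  then have "\<lfloor>real a ^ r * frac x\<rfloor> < int (a ^ r)"
    by (simp add: floor_less_iff)
  then show ?thesis using base_ge_2 by (auto simp: cell_def nat_less_iff)
qed

lemma cell_Suc: "cell (Suc n) x = a * cell n x + adic_digit n x"
proof -
  have "frac (real a ^ n * frac x) = frac (real a ^ n * x)"
  proof -
    have "real a ^ n * x = of_int (int a ^ n * \<lfloor>x\<rfloor>) + real a ^ n * frac x"
      by (simp add: frac_def algebra_simps)
    then show ?thesis by (simp add: frac_def)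
  qed
  then show ?thesis
    using floor_power_Suc[of "frac x" n] by (simp add: cell_def adic_digit_def)
qed

lemma walsh_cong_cell:
  assumes "k < a ^ m" "cell m x = cell m y"
  shows "walsh a k x = walsh a k y"
  using assms
proof (induction m arbitrary: k)
  case 0
  then show ?case by (simp add: walsh_0)
next
  case (Suc m)
  have "cell (Suc m) z mod a = adic_digit m z" "cell (Suc m) z div a = cell m z" for z
    using adic_digit_less[of m z] by (simp_all add: cell_Suc)
  then have eq: "adic_digit m x = adic_digit m y" "cell m x = cell m y"
    using Suc.prems(2) by metis+
  have "k div a ^ m < a"
    using Suc.prems(1) by (simp add: less_mult_imp_div_less)
  then have "walsh a (k mod a ^ m + k div a ^ m * a ^ m) z =
      walsh a (k mod a ^ m) z * rademacher a m z ^ (k div a ^ m)" for z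
    using base_ge_2 by (subst walsh_split) (simp_all add: walsh_less_base rademacher_shift)
  moreover have "walsh a (k mod a ^ m) x = walsh a (k mod a ^ m) y"
    using base_ge_2 eq by (intro Suc.IH) simp
  ultimately show ?case
    using eq by (simp only: rademacher_digit mod_div_mult_eq)
qed

text \<open>Orthogonality on the grid of mesh \<open>a\<^sup>-\<^sup>m\<close>. The lowest digit of the frequency is paired with the leading digit of
the grid point; both are split off in the induction step.\<close>

lemma walsh_orthogonal:
  assumes "k < a ^ m" "k' < a ^ m"
  shows "(\<Sum>l<a ^ m. walsh a k (real l / real a ^ m) * cnj (walsh a k' (real l / real a ^ m)))
     = (if k = k' then of_nat (a ^ m) else 0)"
  using assms
proof (induction m arbitrary: k k')
  case 0
  then show ?case by (simp add: walsh_0)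
next
  case (Suc m)
  define f where "f l = walsh a k (real l / real a ^ Suc m) * cnj (walsh a k' (real l / real a ^ Suc m))" for l
  have split: "walsh a k (real (l + j * a ^ m) / real a ^ Suc m) = (cis (2 * pi / real a) ^ (k mod a)) ^ j * walsh a (k div a) (real l / real a ^ m)"
    if "l < a ^ m" "j < a" for j l k
  proof -
    let ?x = "real (l + j * a ^ m) / real a ^ Suc m"
    have x: "real a * ?x = real j + real l / real a ^ m"
      using base_ge_2 by (simp add: field_simps power_Suc)
    have l1: "real l / real a ^ m < 1" using that(1) base_ge_2
      by (simp add: divide_less_eq)
    have "real j + real l / real a ^ m < real a"
      using l1 that(2) by linarith
    then have "real a * ?x < real a * 1" using x by simp
    then have "?x < 1" by (rule mult_left_less_imp_less) simp
    then have "frac ?x = ?x" by (simp add: frac_eq)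
    then have "adic_digit 0 ?x = j"
      using x l1 by (simp add: adic_digit_def floor_unique nat_eq_iff)
    moreover have "walsh a (k mod a + k div a * a ^ 1) ?x = walsh a (k mod a) ?x * walsh a (k div a) (real a ^ 1 * ?x)"
      using base_ge_2 by (intro walsh_split) simp
    ultimately show ?thesis
      using base_ge_2 x by (simp add: walsh_less_base rademacher_digit walsh_Ints_shift power_mult[symmetric] mult.commute)
  qed
  have kd: "k div a < a ^ m" "k' div a < a ^ m"
    using Suc.prems base_ge_2 by (auto simp: less_mult_imp_div_less mult.commute)
  have "(\<Sum>l<a ^ Suc m. f l) = (\<Sum>j<a. \<Sum>l<a ^ m. f (l + j * a ^ m))"
    using base_ge_2 sum_split_base[of "a ^ m" f a] by (simp add: mult.commute)
  also have "\<dots> = (\<Sum>j<a. \<Sum>l<a ^ m.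
       (cis (2 * pi / real a) ^ (k mod a) * cnj (cis (2 * pi / real a) ^ (k' mod a))) ^ j *
       (walsh a (k div a) (real l / real a ^ m) * cnj (walsh a (k' div a) (real l / real a ^ m))))"
    unfolding f_def by (intro sum.cong refl) (auto simp: split power_mult_distrib mult_ac simp del: power_Suc of_nat_add)
  also have "\<dots> = (\<Sum>j<a. (cis (2 * pi / real a) ^ (k mod a) * cnj (cis (2 * pi / real a) ^ (k' mod a))) ^ j) *
       (\<Sum>l<a ^ m. walsh a (k div a) (real l / real a ^ m) * cnj (walsh a (k' div a) (real l / real a ^ m)))"
    by (simp only: sum_product)
  also have "\<dots> = (if k mod a = k' mod a then of_nat a else 0) * (if k div a = k' div a then of_nat (a ^ m) else 0)"
    using base_ge_2 by (subst Suc.IH[OF kd], subst root_of_unity_sum) auto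
  also have "\<dots> = (if k = k' then of_nat (a ^ Suc m) else 0)"
    by (auto) (metis div_mult_mod_eq)+
  finally show ?case by (simp add: f_def)
qed

lemma measurable_rademacher [measurable]: "rademacher a j \<in> borel_measurable borel"
proof -
  have [measurable]: "(\<lambda>x::real. frac x) \<in> borel_measurable borel"
    unfolding frac_def by measurable
  have "(\<lambda>x. real a * frac (real a ^ j * x)) \<in> borel_measurable borel"
    by measurable
  then have "(\<lambda>x. \<lfloor>real a * frac (real a ^ j * x)\<rfloor>) \<in> measurable borel (count_space UNIV)"
    by measurable
  then have "(\<lambda>x. cis (2 * pi / real a) ^ nat \<lfloor>real a * frac (real a ^ j * x)\<rfloor>) \<in> borel_measurable borel"
    by (rule measurable_compose) simp
  then show ?thesis by (simp add: rademacher_def[abs_def] rademacher0_def)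
qed

lemma measurable_walsh [measurable]: "walsh a n \<in> borel_measurable borel"
  unfolding walsh_def[abs_def] by measurable

lemma measurable_cell [measurable]: "cell r \<in> measurable borel (count_space UNIV)"
proof -
  have [measurable]: "(\<lambda>x::real. frac x) \<in> borel_measurable borel"
    unfolding frac_def by measurable
  have "(\<lambda>x. real a ^ r * frac x) \<in> borel_measurable borel"
    by measurable
  then have "(\<lambda>x. \<lfloor>real a ^ r * frac x\<rfloor>) \<in> measurable borel (count_space UNIV)"
    by measurable
  then have "(\<lambda>x. nat \<lfloor>real a ^ r * frac x\<rfloor>) \<in> measurable borel (count_space UNIV)"
    by (rule measurable_compose) simp
  then show ?thesis by (simp add: cell_def[abs_def])
qed

end

section \<open>Integration over the square by averaging over cells\<close>

lemma unit_square_sets: "unit_square \<in> sets (lebesgue :: (real \<times> real) measure)"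
  by (intro sets_completionI_sets) (simp add: closed_Times borel_closed)

context adic_base
begin

definition grid :: "nat \<Rightarrow> nat \<Rightarrow> real" where
  "grid m i = real i / real a ^ m"

lemma cell_eq_iff:
  assumes "0 \<le> x" "x < 1"
  shows "cell m x = i \<longleftrightarrow> grid m i \<le> x \<and> x < grid m (Suc i)"
proof -
  have "real a ^ m > 0" using base_ge_2 by simp
  moreover have "frac x = x" using assms by (simp add: frac_eq)
  moreover have "\<lfloor>real a ^ m * x\<rfloor> \<ge> 0" using assms by simp
  ultimately show ?thesis
    by (auto simp: cell_def grid_def field_simps nat_eq_iff floor_eq_iff)
qed

lemma AE_lborel_less_1: "AE z in (lborel :: (real \<times> real) measure). fst z \<noteq> 1 \<and> snd z \<noteq> 1"
proof (rule AE_I')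
  have "emeasure (lborel \<Otimes>\<^sub>M lborel) ({1::real} \<times> (UNIV :: real set)) = 0"
    by (subst lborel.emeasure_pair_measure_Times) auto
  moreover have "emeasure (lborel \<Otimes>\<^sub>M lborel) ((UNIV :: real set) \<times> {1::real}) = 0"
    by (subst lborel.emeasure_pair_measure_Times) auto
  ultimately show "{1::real} \<times> (UNIV :: real set) \<union> (UNIV :: real set) \<times> {1::real} \<in> null_sets lborel"
    unfolding lborel_prod
    by (intro null_sets.Un null_setsI) (auto simp: borel_prod[symmetric])
qed auto

lemma nn_integral_unit_square:
  "(\<integral>\<^sup>+z. G z \<partial>lebesgue_on unit_square) = (\<integral>\<^sup>+z. G z * indicator ({0..<1} \<times> {0..<1}) z \<partial>lborel)"
proof -
  from unit_square_sets have "(\<integral>\<^sup>+z. G z \<partial>lebesgue_on unit_square) = (\<integral>\<^sup>+z. G z * indicator unit_square z \<partial>lborel)"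
    by (subst nn_integral_restrict_space) (auto simp: nn_integral_completion)
  also have "\<dots> = (\<integral>\<^sup>+z. G z * indicator ({0..<1} \<times> {0..<1}) z \<partial>lborel)"
    by (rule nn_integral_cong_AE, rule AE_mp[OF AE_lborel_less_1]) (auto simp: indicator_def)
  finally show ?thesis .
qed

text \<open>A function that is constant on cells is integrated by averaging its values at the corners of
the cells, which turns integrals of Walsh polynomials into finite sums.\<close>

lemma nn_integral_cells:
  fixes G :: "real \<times> real \<Rightarrow> ennreal"
  assumes "\<And>x y x' y'. cell m x = cell m x' \<Longrightarrow> cell m y = cell m y' \<Longrightarrow> G (x, y) = G (x', y')"
  shows "(\<integral>\<^sup>+z. G z \<partial>lebesgue_on unit_square) =
    (\<Sum>i<a ^ m. \<Sum>j<a ^ m. G (grid m i, grid m j) * ennreal (1 / (real a ^ m)\<^sup>2))"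
proof -
  define I where "I i = {grid m i..<grid m (Suc i)}" for i
  have I01: "I i \<subseteq> {0..<1}" if "i < a ^ m" for i
  proof -
    have "grid m (Suc i) \<le> 1" using that base_ge_2
      by (auto simp: grid_def divide_le_eq simp flip: of_nat_power of_nat_Suc)
    moreover have "grid m i \<ge> 0" by (simp add: grid_def)
    ultimately show ?thesis by (auto simp: I_def)
  qed
  have eq: "G z * indicator ({0..<1} \<times> {0..<1}) z =
    (\<Sum>i<a ^ m. \<Sum>j<a ^ m. G (grid m i, grid m j) * indicator (I i \<times> I j) z)" for z
  proof (cases "z \<in> {0..<1} \<times> {0..<1}")
    case False
    then have "indicator (I i \<times> I j) z = (0::ennreal)" if "i < a ^ m" "j < a ^ m" for i j
      using I01[OF that(1)] I01[OF that(2)] by (auto simp: indicator_def)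
    with False show ?thesis by simp
  next
    case True
    then obtain x y where z: "z = (x, y)" and x: "0 \<le> x" "x < 1" and y: "0 \<le> y" "y < 1" by auto
    have ind: "indicator (I i \<times> I j) z = (if i = cell m x then if j = cell m y then 1 else 0 else (0::ennreal))" for i j
      using cell_eq_iff[OF x, of m i] cell_eq_iff[OF y, of m j] by (auto simp: indicator_def I_def z)
    have "(\<Sum>i<a ^ m. \<Sum>j<a ^ m. G (grid m i, grid m j) * indicator (I i \<times> I j) z) =
      (\<Sum>i<a ^ m. if i = cell m x then \<Sum>j<a ^ m. if j = cell m y then G (grid m i, grid m j) else 0 else 0)"
    proof (rule sum.cong[OF refl])
      fix i assume "i \<in> {..<a ^ m}"
      show "(\<Sum>j<a ^ m. G (grid m i, grid m j) * indicator (I i \<times> I j) z) =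
        (if i = cell m x then \<Sum>j<a ^ m. if j = cell m y then G (grid m i, grid m j) else 0 else 0)"
        unfolding ind by (cases "i = cell m x") (auto intro!: sum.cong simp del: sum.delta)
    qed
    also have "\<dots> = G (grid m (cell m x), grid m (cell m y))"
      using cell_less[of m x] cell_less[of m y]
      by (simp only: sum.delta[OF finite_lessThan] lessThan_iff if_True)
    also have "\<dots> = G (x, y)"
      by (rule assms) (simp_all add: grid_def cell_grid_point cell_less)
    finally show ?thesis using True z by simp
  qed
  have meas: "I i \<times> I j \<in> sets (lborel :: (real \<times> real) measure)" for i j
    unfolding lborel_prod[symmetric] I_def by simp
  have em: "emeasure lborel (I i \<times> I j) = ennreal (1 / (real a ^ m)\<^sup>2)" for i j
  proof -
    have le: "grid m i \<le> grid m (Suc i)" for i using base_ge_2 by (simp add: grid_def divide_right_mono)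
    have len: "grid m (Suc i) - grid m i = 1 / real a ^ m" for i
      using base_ge_2 by (simp add: grid_def diff_divide_distrib[symmetric])
    have "emeasure (lborel \<Otimes>\<^sub>M lborel) (I i \<times> I j) = emeasure lborel (I i) * emeasure lborel (I j)"
      unfolding I_def by (rule lborel.emeasure_pair_measure_Times) auto
    also have "\<dots> = ennreal (1 / (real a ^ m)\<^sup>2)"
      unfolding I_def by (simp add: le len ennreal_mult[symmetric] power2_eq_square)
    finally show ?thesis by (simp add: lborel_prod)
  qed
  have "(\<integral>\<^sup>+z. G z \<partial>lebesgue_on unit_square) =
     (\<integral>\<^sup>+z. (\<Sum>i<a ^ m. \<Sum>j<a ^ m. G (grid m i, grid m j) * indicator (I i \<times> I j) z) \<partial>lborel)"
    unfolding nn_integral_unit_square eq ..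
  also have "\<dots> = (\<Sum>i<a ^ m. \<Sum>j<a ^ m. G (grid m i, grid m j) * emeasure lborel (I i \<times> I j))"
  proof -
    have m: "(\<lambda>z. G (grid m i, grid m j) * indicator (I i \<times> I j) z) \<in> borel_measurable lborel" for i j
      by (intro borel_measurable_times_ennreal borel_measurable_const borel_measurable_indicator meas)
    show ?thesis
      by (simp only: nn_integral_sum m borel_measurable_sum nn_integral_cmult_indicator[OF meas])
  qed
  finally show ?thesis by (simp only: em)
qed

definition walsh_poly :: "(nat \<times> nat \<Rightarrow> complex) \<Rightarrow> (nat \<times> nat) set \<Rightarrow> real \<times> real \<Rightarrow> complex" where
  "walsh_poly C G = (\<lambda>(x, y). \<Sum>(k, \<nu>)\<in>G. C (k, \<nu>) * walsh a k x * walsh a \<nu> y)"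

lemma walsh_poly_parseval:
  assumes "G \<subseteq> {..<a ^ m} \<times> {..<a ^ m}"
  shows "(\<Sum>i<a ^ m. \<Sum>j<a ^ m. (norm (walsh_poly C G (grid m i, grid m j)))\<^sup>2) =
    (real a ^ m)\<^sup>2 * (\<Sum>p\<in>G. (norm (C p))\<^sup>2)"
proof -
  have fin: "finite G" using assms by (rule finite_subset) simp
  define W where "W p i j = walsh a (fst p) (grid m i) * walsh a (snd p) (grid m j)" for p i j
  have F: "walsh_poly C G (grid m i, grid m j) = (\<Sum>p\<in>G. C p * W p i j)" for i j
    by (simp add: walsh_poly_def W_def split_beta mult.assoc)
  have ortho: "(\<Sum>i<a ^ m. \<Sum>j<a ^ m. W p i j * cnj (W q i j)) = (if p = q then of_nat (a ^ m) ^ 2 else 0)"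
    if "p \<in> G" "q \<in> G" for p q
  proof -
    have "(\<Sum>i<a ^ m. \<Sum>j<a ^ m. W p i j * cnj (W q i j)) =
      (\<Sum>i<a ^ m. \<Sum>j<a ^ m. (walsh a (fst p) (grid m i) * cnj (walsh a (fst q) (grid m i))) *
        (walsh a (snd p) (grid m j) * cnj (walsh a (snd q) (grid m j))))"
      by (intro sum.cong refl) (simp add: W_def mult_ac)
    also have "\<dots> = (\<Sum>i<a ^ m. walsh a (fst p) (grid m i) * cnj (walsh a (fst q) (grid m i))) *
        (\<Sum>j<a ^ m. walsh a (snd p) (grid m j) * cnj (walsh a (snd q) (grid m j)))"
      by (simp only: sum_product)
    also have "\<dots> = (if fst p = fst q then of_nat (a ^ m) else 0) * (if snd p = snd q then of_nat (a ^ m) else 0)"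
      unfolding grid_def using that assms by (subst (1 2) walsh_orthogonal) auto
    also have "\<dots> = (if p = q then of_nat (a ^ m) ^ 2 else 0)"
      by (auto simp: prod_eq_iff power2_eq_square)
    finally show ?thesis .
  qed
  have "complex_of_real (\<Sum>i<a ^ m. \<Sum>j<a ^ m. (norm (walsh_poly C G (grid m i, grid m j)))\<^sup>2) =
    (\<Sum>i<a ^ m. \<Sum>j<a ^ m. \<Sum>p\<in>G. \<Sum>q\<in>G. C p * cnj (C q) * (W p i j * cnj (W q i j)))"
    by (simp add: complex_norm_square F sum_product mult_ac del: of_real_power)
  also have "\<dots> = (\<Sum>p\<in>G. \<Sum>q\<in>G. C p * cnj (C q) * (\<Sum>i<a ^ m. \<Sum>j<a ^ m. W p i j * cnj (W q i j)))"
  proof -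
    have "(\<Sum>i<a ^ m. \<Sum>j<a ^ m. \<Sum>p\<in>G. \<Sum>q\<in>G. f p q i j) = (\<Sum>p\<in>G. \<Sum>q\<in>G. \<Sum>i<a ^ m. \<Sum>j<a ^ m. f p q i j)"
      for f :: "nat \<times> nat \<Rightarrow> nat \<times> nat \<Rightarrow> nat \<Rightarrow> nat \<Rightarrow> complex"
    proof -
      have "(\<Sum>i<a ^ m. \<Sum>j<a ^ m. \<Sum>p\<in>G. \<Sum>q\<in>G. f p q i j) = (\<Sum>i<a ^ m. \<Sum>p\<in>G. \<Sum>q\<in>G. \<Sum>j<a ^ m. f p q i j)"
        by (intro sum.cong refl, subst sum.swap, intro sum.cong refl, rule sum.swap)
      also have "\<dots> = (\<Sum>p\<in>G. \<Sum>q\<in>G. \<Sum>i<a ^ m. \<Sum>j<a ^ m. f p q i j)"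
        by (subst sum.swap, intro sum.cong refl, rule sum.swap)
      finally show ?thesis .
    qed
    then show ?thesis by (simp only: sum_distrib_left)
  qed
  also have "\<dots> = (\<Sum>p\<in>G. \<Sum>q\<in>G. if p = q then C p * cnj (C p) * of_nat (a ^ m) ^ 2 else 0)"
    by (intro sum.cong refl) (auto simp: ortho)
  also have "\<dots> = (\<Sum>p\<in>G. C p * cnj (C p) * of_nat (a ^ m) ^ 2)"
    using fin by simp
  also have "\<dots> = complex_of_real ((real a ^ m)\<^sup>2 * (\<Sum>p\<in>G. (norm (C p))\<^sup>2))"
    by (simp add: complex_norm_square sum_distrib_left mult_ac del: of_real_power flip: of_nat_power)
  finally show ?thesis by (simp only: of_real_eq_iff)
qed

text \<open>The \<open>L\<^sup>1\<close> norm is at most the \<open>L\<^sup>2\<close> norm, which is the square root of the sum of the squared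
coefficients. The index set is arbitrary, so that the bound covers partial sums of every shape.\<close>

lemma nn_integral_walsh_poly_le:
  assumes "G \<subseteq> {..<a ^ m} \<times> {..<a ^ m}" "\<delta> > 0" "(\<Sum>p\<in>G. (norm (C p))\<^sup>2) \<le> \<delta>\<^sup>2"
  shows "(\<integral>\<^sup>+z. ennreal (norm (walsh_poly C G z)) \<partial>lebesgue_on unit_square) \<le> ennreal \<delta>"
proof -
  let ?A = "real a ^ m"
  let ?f = "\<lambda>i j. norm (walsh_poly C G (grid m i, grid m j))"
  have inv: "walsh_poly C G (x, y) = walsh_poly C G (x', y')"
    if "cell m x = cell m x'" "cell m y = cell m y'" for x y x' y'
    unfolding walsh_poly_def prod.case
  proof (intro sum.cong refl, clarify)
    fix k \<nu> assume "(k, \<nu>) \<in> G"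
    then have "k < a ^ m" "\<nu> < a ^ m" using assms(1) by auto
    then show "C (k, \<nu>) * walsh a k x * walsh a \<nu> y = C (k, \<nu>) * walsh a k x' * walsh a \<nu> y'"
      using walsh_cong_cell that by metis
  qed
  have A: "?A > 0" using base_ge_2 by simp
  have "(\<integral>\<^sup>+z. ennreal (norm (walsh_poly C G z)) \<partial>lebesgue_on unit_square) =
     (\<Sum>i<a ^ m. \<Sum>j<a ^ m. ennreal (?f i j) * ennreal (1 / ?A\<^sup>2))"
    by (rule nn_integral_cells) (auto dest: inv)
  also have "\<dots> = ennreal (\<Sum>i<a ^ m. \<Sum>j<a ^ m. ?f i j * (1 / ?A\<^sup>2))"
    by (simp add: sum_ennreal ennreal_mult[symmetric] sum_nonneg)
  also have "\<dots> \<le> ennreal \<delta>"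
  proof (rule ennreal_leI)
    \<comment> \<open>Averaging this inequality replaces the Cauchy-Schwarz inequality.\<close>
    have "t \<le> (t\<^sup>2 / \<delta> + \<delta>) / 2" for t
      using assms(2) zero_le_power2[of "t - \<delta>"] by (simp add: field_simps power2_eq_square)
    then have "(\<Sum>i<a ^ m. \<Sum>j<a ^ m. ?f i j * (1 / ?A\<^sup>2)) \<le>
      (\<Sum>i<a ^ m. \<Sum>j<a ^ m. ((?f i j)\<^sup>2 / \<delta> + \<delta>) / 2 * (1 / ?A\<^sup>2))"
      by (intro sum_mono mult_right_mono) auto
    also have "\<dots> = ((\<Sum>i<a ^ m. \<Sum>j<a ^ m. (?f i j)\<^sup>2) / \<delta> + ?A\<^sup>2 * \<delta>) / (2 * ?A\<^sup>2)"
      by (simp add: sum.distrib sum_divide_distrib[symmetric] power2_eq_square)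
    also have "\<dots> = ((\<Sum>p\<in>G. (norm (C p))\<^sup>2) / \<delta> + \<delta>) / 2"
      unfolding walsh_poly_parseval[OF assms(1)] using A by (simp add: field_simps)
    also have "\<dots> \<le> (\<delta>\<^sup>2 / \<delta> + \<delta>) / 2"
      using assms by (intro divide_right_mono add_right_mono) auto
    also have "\<dots> = \<delta>" using assms(2) by (simp add: power2_eq_square)
    finally show "(\<Sum>i<a ^ m. \<Sum>j<a ^ m. ?f i j * (1 / ?A\<^sup>2)) \<le> \<delta>" .
  qed
  finally show ?thesis .
qed

section \<open>Blocks\<close>

lemma walsh_at_0 [simp]: "walsh a k 0 = 1"
  by (simp add: walsh_def rademacher_digit adic_digit_def)

lemma cell_0 [simp]: "cell p 0 = 0"
  by (simp add: cell_def)

lemma cell_indicator_expansion: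
  assumes "i < a ^ r"
  shows "of_bool (cell r x = i) = (\<Sum>k<a ^ r. cnj (walsh a k (grid r i)) / of_nat (a ^ r) * walsh a k x)"
proof -
  have "(\<Sum>k<a ^ r. walsh a k x * cnj (walsh a k (grid r i))) = of_nat (a ^ r) * of_bool (cell r x = i)"
    using assms by (simp add: walsh_kernel grid_def cell_grid_point)
  moreover have "of_nat (a ^ r) \<noteq> (0 :: complex)" using base_ge_2 by simp
  ultimately have "of_bool (cell r x = i) = (\<Sum>k<a ^ r. walsh a k x * cnj (walsh a k (grid r i))) / of_nat (a ^ r)"
    by (metis nonzero_mult_div_cancel_left)
  then show ?thesis by (simp add: sum_divide_distrib mult_ac)
qed

text \<open>The function \<open>h(a\<^sup>n x)\<close>: one minus the Dirichlet kernel of order \<open>a\<^sup>p\<close>, hence of mean zero.\<close>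

definition spike :: "nat \<Rightarrow> nat \<Rightarrow> real \<Rightarrow> real" where
  "spike n p x = 1 - real a ^ p * of_bool (cell p (real a ^ n * x) = 0)"

lemma spike_expansion:
  "complex_of_real (spike n p x) = - (\<Sum>m\<in>{1..<a ^ p}. walsh a m (real a ^ n * x))"
proof -
  have "(\<Sum>m<a ^ p. walsh a m (real a ^ n * x)) = of_nat (a ^ p) * of_bool (cell p (real a ^ n * x) = 0)"
    using walsh_kernel[where n = p and x = "real a ^ n * x" and y = 0] by simp
  moreover have "{..<a ^ p} = insert 0 {1..<a ^ p}" using base_ge_2 by auto
  ultimately show ?thesis
    by (simp add: spike_def walsh_0 algebra_simps)
qed

definition bump :: "nat \<Rightarrow> nat \<Rightarrow> nat \<Rightarrow> nat \<Rightarrow> real \<Rightarrow> real" where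
  "bump r i n p x = of_bool (cell r x = i) * spike n p x"

definition bump_coeff :: "nat \<Rightarrow> nat \<Rightarrow> nat \<Rightarrow> nat \<Rightarrow> complex" where
  "bump_coeff r i n \<kappa> =
     (if \<kappa> mod a ^ n < a ^ r then - cnj (walsh a (\<kappa> mod a ^ n) (grid r i)) / of_nat (a ^ r) else 0)"

lemma sum_frequency_block:
  fixes f :: "nat \<Rightarrow> 'b :: ab_group_add"
  shows "(\<Sum>\<kappa>\<in>{a ^ n..<a ^ (n + p)}. f \<kappa>) = (\<Sum>m\<in>{1..<a ^ p}. \<Sum>k<a ^ n. f (k + m * a ^ n))"
proof -
  have "a ^ n \<le> a ^ (n + p)" using base_ge_2 by (intro power_increasing) auto
  then have "(\<Sum>\<kappa><a ^ n. f \<kappa>) + (\<Sum>\<kappa>\<in>{a ^ n..<a ^ (n + p)}. f \<kappa>) = (\<Sum>\<kappa><a ^ n * a ^ p. f \<kappa>)"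
    by (simp add: lessThan_atLeast0 sum.atLeastLessThan_concat power_add)
  also have "\<dots> = (\<Sum>m<a ^ p. \<Sum>k<a ^ n. f (k + m * a ^ n))"
    using base_ge_2 by (intro sum_split_base) simp
  also have "{..<a ^ p} = insert 0 {1..<a ^ p}" using base_ge_2 by auto
  finally show ?thesis by simp
qed

text \<open>The indicator of the cell has frequencies below \<open>a\<^sup>r \<le> a\<^sup>n\<close>, the spike has the frequencies \<open>m a\<^sup>n\<close> with
\<open>1 \<le> m < a\<^sup>p\<close>; the products are Walsh functions with frequencies from \<open>a\<^sup>n\<close> up to \<open>a\<^sup>n\<^sup>+\<^sup>p\<close>.\<close>

lemma bump_expansion:
  assumes "r \<le> n" "i < a ^ r"
  shows "complex_of_real (bump r i n p x) = (\<Sum>\<kappa>\<in>{a ^ n..<a ^ (n + p)}. bump_coeff r i n \<kappa> * walsh a \<kappa> x)"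
proof -
  let ?c = "\<lambda>k. cnj (walsh a k (grid r i)) / of_nat (a ^ r)"
  have le: "a ^ r \<le> a ^ n" using assms base_ge_2 by (intro power_increasing) auto
  have "(\<Sum>\<kappa>\<in>{a ^ n..<a ^ (n + p)}. bump_coeff r i n \<kappa> * walsh a \<kappa> x) =
     (\<Sum>m\<in>{1..<a ^ p}. \<Sum>k<a ^ n. bump_coeff r i n (k + m * a ^ n) * walsh a (k + m * a ^ n) x)"
    by (rule sum_frequency_block)
  also have "\<dots> = (\<Sum>m\<in>{1..<a ^ p}. \<Sum>k<a ^ r. - (?c k * walsh a k x) * walsh a m (real a ^ n * x))"
  proof (rule sum.cong[OF refl])
    fix m
    have "(\<Sum>k<a ^ n. bump_coeff r i n (k + m * a ^ n) * walsh a (k + m * a ^ n) x) =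
      (\<Sum>k<a ^ n. if k < a ^ r then - (?c k * walsh a k x) * walsh a m (real a ^ n * x) else 0)"
      by (intro sum.cong refl) (auto simp: bump_coeff_def walsh_split)
    also have "\<dots> = (\<Sum>k<a ^ r. - (?c k * walsh a k x) * walsh a m (real a ^ n * x))"
      using le by (intro sum.mono_neutral_cong_right) auto
    finally show "(\<Sum>k<a ^ n. bump_coeff r i n (k + m * a ^ n) * walsh a (k + m * a ^ n) x) =
      (\<Sum>k<a ^ r. - (?c k * walsh a k x) * walsh a m (real a ^ n * x))" .
  qed
  also have "\<dots> = (\<Sum>k<a ^ r. ?c k * walsh a k x) * - (\<Sum>m\<in>{1..<a ^ p}. walsh a m (real a ^ n * x))"
    by (subst sum.swap) (simp add: sum_product sum_negf)
  also have "\<dots> = complex_of_real (bump r i n p x)"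
    unfolding cell_indicator_expansion[OF assms(2), symmetric] spike_expansion[symmetric]
    by (simp add: bump_def)
  finally show ?thesis ..
qed

text \<open>All nonzero coefficients have the same modulus \<open>a\<^sup>-\<^sup>r\<close>, and there are \<open>(a\<^sup>p - 1) a\<^sup>r\<close> of them. The
function \<open>\<phi>\<close> is a power in the applications.\<close>

lemma bump_coeff_sum:
  fixes \<phi> :: "real \<Rightarrow> real"
  assumes "r \<le> n" "\<phi> 0 = 0"
  shows "(\<Sum>\<kappa>\<in>{a ^ n..<a ^ (n + p)}. \<phi> (norm (bump_coeff r i n \<kappa>))) = (real a ^ p - 1) * real a ^ r * \<phi> (1 / real a ^ r)"
proof -
  have le: "a ^ r \<le> a ^ n" using assms base_ge_2 by (intro power_increasing) auto
  have ge1: "1 \<le> a ^ p" using base_ge_2 by simp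
  have "(\<Sum>k<a ^ n. \<phi> (norm (bump_coeff r i n (k + m * a ^ n)))) = real a ^ r * \<phi> (1 / real a ^ r)" for m
  proof -
    have "(\<Sum>k<a ^ n. \<phi> (norm (bump_coeff r i n (k + m * a ^ n)))) = (\<Sum>k<a ^ n. if k < a ^ r then \<phi> (1 / real a ^ r) else 0)"
      using assms(2) by (intro sum.cong refl) (auto simp: bump_coeff_def norm_divide norm_power)
    also have "\<dots> = (\<Sum>k<a ^ r. \<phi> (1 / real a ^ r))"
      using le by (intro sum.mono_neutral_cong_right) auto
    finally show ?thesis by simp
  qed
  then show ?thesis
    unfolding sum_frequency_block using ge1 by (simp add: of_nat_diff)
qed

definition frequencies :: "nat \<Rightarrow> nat \<Rightarrow> (nat \<times> nat) set" where
  "frequencies n p = {a ^ n..<a ^ (n + p)} \<times> {a ^ n..<a ^ (n + p)}"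

definition block_coeff :: "real \<Rightarrow> nat \<Rightarrow> nat \<Rightarrow> nat \<Rightarrow> nat \<Rightarrow> nat \<times> nat \<Rightarrow> complex" where
  "block_coeff \<gamma> r i j n = (\<lambda>(\<kappa>, \<nu>). of_real \<gamma> * bump_coeff r i n \<kappa> * bump_coeff r j n \<nu>)"

definition block :: "real \<Rightarrow> nat \<Rightarrow> nat \<Rightarrow> nat \<Rightarrow> nat \<Rightarrow> nat \<Rightarrow> real \<times> real \<Rightarrow> real" where
  "block \<gamma> r i j n p = (\<lambda>(x, y). \<gamma> * bump r i n p x * bump r j n p y)"

definition square_step :: "real \<Rightarrow> nat \<Rightarrow> nat \<Rightarrow> nat \<Rightarrow> real \<times> real \<Rightarrow> real" where
  "square_step \<gamma> r i j = (\<lambda>(x, y). \<gamma> * of_bool (cell r x = i) * of_bool (cell r y = j))"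

text \<open>The points of the square where the spike in one of the variables differs from 1, so that the block may
differ from the step function.\<close>

definition bad_set :: "nat \<Rightarrow> nat \<Rightarrow> nat \<Rightarrow> nat \<Rightarrow> nat \<Rightarrow> (real \<times> real) set" where
  "bad_set r i j n p = {(x, y) \<in> unit_square. cell r x = i \<and> cell r y = j \<and>
     (cell p (real a ^ n * x) = 0 \<or> cell p (real a ^ n * y) = 0)}"

lemma block_expansion:
  assumes "r \<le> n" "i < a ^ r" "j < a ^ r"
  shows "walsh_poly (block_coeff \<gamma> r i j n) (frequencies n p) z = complex_of_real (block \<gamma> r i j n p z)"
proof (cases z)
  case (Pair x y)
  have "walsh_poly (block_coeff \<gamma> r i j n) (frequencies n p) z =
    (\<Sum>\<kappa>\<in>{a ^ n..<a ^ (n + p)}. \<Sum>\<nu>\<in>{a ^ n..<a ^ (n + p)}.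
      of_real \<gamma> * ((bump_coeff r i n \<kappa> * walsh a \<kappa> x) * (bump_coeff r j n \<nu> * walsh a \<nu> y)))"
    by (simp add: walsh_poly_def Pair frequencies_def block_coeff_def sum.cartesian_product split_beta mult_ac)
  also have "\<dots> = of_real \<gamma> * (complex_of_real (bump r i n p x) * complex_of_real (bump r j n p y))"
    unfolding bump_expansion[OF assms(1,2)] bump_expansion[OF assms(1,3)]
    by (subst sum_product) (simp only: sum_distrib_left)
  also have "\<dots> = complex_of_real (block \<gamma> r i j n p z)"
    by (simp add: block_def Pair)
  finally show ?thesis .
qed

lemma block_coeff_sum:
  assumes "r \<le> n" "q > 0"
  shows "(\<Sum>p\<in>frequencies n p. norm (block_coeff \<gamma> r i j n p) powr q) =
    (\<bar>\<gamma>\<bar> / (real a ^ r)\<^sup>2) powr q * ((real a ^ p - 1) * real a ^ r)\<^sup>2"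
proof -
  have A: "real a ^ r > 0" using base_ge_2 by simp
  have "(\<Sum>p\<in>frequencies n p. norm (block_coeff \<gamma> r i j n p) powr q) =
    (\<Sum>\<kappa>\<in>{a ^ n..<a ^ (n + p)}. \<Sum>\<nu>\<in>{a ^ n..<a ^ (n + p)}.
      \<bar>\<gamma>\<bar> powr q * (norm (bump_coeff r i n \<kappa>) powr q * norm (bump_coeff r j n \<nu>) powr q))"
    by (simp add: frequencies_def block_coeff_def norm_mult powr_mult sum.cartesian_product split_beta mult_ac)
  also have "\<dots> = \<bar>\<gamma>\<bar> powr q * ((\<Sum>\<kappa>\<in>{a ^ n..<a ^ (n + p)}. norm (bump_coeff r i n \<kappa>) powr q) *
       (\<Sum>\<nu>\<in>{a ^ n..<a ^ (n + p)}. norm (bump_coeff r j n \<nu>) powr q))"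
    by (subst sum_product) (simp only: sum_distrib_left)
  also have "\<dots> = \<bar>\<gamma>\<bar> powr q * ((real a ^ p - 1) * real a ^ r * (1 / real a ^ r) powr q)\<^sup>2"
    using bump_coeff_sum[OF assms(1), of "\<lambda>t. t powr q"] assms(2) by (simp add: power2_eq_square)
  also have "\<dots> = (\<bar>\<gamma>\<bar> / (real a ^ r)\<^sup>2) powr q * ((real a ^ p - 1) * real a ^ r)\<^sup>2"
    using A by (simp add: powr_divide powr_mult power2_eq_square field_simps)
  finally show ?thesis .
qed

lemma block_coeff_sum_squares:
  assumes "r \<le> n"
  shows "(\<Sum>p\<in>frequencies n p. (norm (block_coeff \<gamma> r i j n p))\<^sup>2) \<le> (\<bar>\<gamma>\<bar> * real a ^ p / real a ^ r)\<^sup>2"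
proof -
  have A: "real a ^ r > 0" using base_ge_2 by simp
  have "1 \<le> real a ^ p" using base_ge_2 by simp
  then have *: "(real a ^ p - 1)\<^sup>2 \<le> (real a ^ p)\<^sup>2" by (intro power_mono) auto
  have "(\<Sum>p\<in>frequencies n p. (norm (block_coeff \<gamma> r i j n p))\<^sup>2) =
    (\<bar>\<gamma>\<bar> / (real a ^ r)\<^sup>2)\<^sup>2 * ((real a ^ p - 1) * real a ^ r)\<^sup>2"
    using block_coeff_sum[OF assms, where q = 2] by simp
  also have "\<dots> \<le> (\<bar>\<gamma>\<bar> / (real a ^ r)\<^sup>2)\<^sup>2 * (real a ^ p * real a ^ r)\<^sup>2"
    using * by (intro mult_left_mono) (simp_all add: power_mult_distrib mult_right_mono)
  also have "\<dots> = (\<bar>\<gamma>\<bar> * real a ^ p / real a ^ r)\<^sup>2"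
    using A base_ge_2 by (simp add: field_simps power2_eq_square)
  finally show ?thesis .
qed

text \<open>For small squares the bound is small even though the block takes values as large as
\<open>|\<gamma>| (a\<^sup>p - 1)\<^sup>2\<close>: this makes it harmless to stop a partial sum in the middle of a block.\<close>

lemma nn_integral_partial_block_le:
  assumes "r \<le> n"
  shows "(\<integral>\<^sup>+z. ennreal (norm (walsh_poly (block_coeff \<gamma> r i j n) (frequencies n p \<inter> G) z)) \<partial>lebesgue_on unit_square)
    \<le> ennreal (\<bar>\<gamma>\<bar> * real a ^ p / real a ^ r)"
proof (cases "\<gamma> = 0")
  case True
  then show ?thesis by (simp add: walsh_poly_def block_coeff_def split_beta)
next
  case False
  show ?thesis
  proof (rule nn_integral_walsh_poly_le[where m = "n + p"])
    show "frequencies n p \<inter> G \<subseteq> {..<a ^ (n + p)} \<times> {..<a ^ (n + p)}" by (auto simp: frequencies_def)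
    show "0 < \<bar>\<gamma>\<bar> * real a ^ p / real a ^ r" using base_ge_2 False by simp
    have "(\<Sum>p\<in>frequencies n p \<inter> G. (norm (block_coeff \<gamma> r i j n p))\<^sup>2) \<le> (\<Sum>p\<in>frequencies n p. (norm (block_coeff \<gamma> r i j n p))\<^sup>2)"
      by (intro sum_mono2) (auto simp: frequencies_def)
    with block_coeff_sum_squares[OF assms]
    show "(\<Sum>p\<in>frequencies n p \<inter> G. (norm (block_coeff \<gamma> r i j n p))\<^sup>2) \<le> (\<bar>\<gamma>\<bar> * real a ^ p / real a ^ r)\<^sup>2"
      by (rule order.trans[rotated])
  qed
qed

lemma block_eq_square_step:
  assumes "z \<in> unit_square - bad_set r i j n p"
  shows "block \<gamma> r i j n p z = square_step \<gamma> r i j z"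
  using assms by (auto simp: block_def square_step_def bad_set_def bump_def spike_def split: prod.splits)

lemma abs_block_diff_le: "\<bar>block \<gamma> r i j n p z - square_step \<gamma> r i j z\<bar> \<le> 2 * \<bar>\<gamma>\<bar> * (real a ^ p)\<^sup>2"
proof -
  obtain x y where z: "z = (x, y)" by force
  have A: "1 \<le> real a ^ p" using base_ge_2 by simp
  have s: "\<bar>bump r i n p x\<bar> \<le> real a ^ p" for i x
    using A by (auto simp: bump_def spike_def of_bool_def)
  have "\<bar>block \<gamma> r i j n p z\<bar> = \<bar>\<gamma>\<bar> * (\<bar>bump r i n p x\<bar> * \<bar>bump r j n p y\<bar>)"
    by (simp add: block_def z abs_mult)
  also have "\<dots> \<le> \<bar>\<gamma>\<bar> * (real a ^ p * real a ^ p)"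
    by (intro mult_left_mono mult_mono s) auto
  finally have "\<bar>block \<gamma> r i j n p z\<bar> \<le> \<bar>\<gamma>\<bar> * (real a ^ p)\<^sup>2" by (simp add: power2_eq_square)
  moreover have "\<bar>square_step \<gamma> r i j z\<bar> \<le> \<bar>\<gamma>\<bar> * (real a ^ p)\<^sup>2"
  proof -
    have "\<bar>square_step \<gamma> r i j z\<bar> \<le> \<bar>\<gamma>\<bar> * 1" by (auto simp: square_step_def z of_bool_def)
    also have "\<dots> \<le> \<bar>\<gamma>\<bar> * (real a ^ p)\<^sup>2" using A by (intro mult_left_mono) (auto simp: one_le_power)
    finally show ?thesis .
  qed
  ultimately show ?thesis by linarith
qed

lemma borel_measurable_block [measurable]: "block \<gamma> r i j n p \<in> borel_measurable borel"
proof -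
  have *: "bump r i n p \<in> borel_measurable borel" for i
    unfolding bump_def[abs_def] spike_def by measurable
  show ?thesis
    unfolding block_def borel_prod[symmetric] using * by measurable
qed

lemma borel_measurable_square_step [measurable]: "square_step \<gamma> r i j \<in> borel_measurable borel"
  unfolding square_step_def borel_prod[symmetric] by measurable

lemma bad_set_sets: "bad_set r i j n p \<in> sets borel"
proof -
  have "{z \<in> space (borel \<Otimes>\<^sub>M borel). fst z \<in> {0..1::real} \<and> snd z \<in> {0..1::real} \<and> cell r (fst z) = i \<and> cell r (snd z) = j \<and>
     (cell p (real a ^ n * fst z) = 0 \<or> cell p (real a ^ n * snd z) = 0)} \<in> sets (borel \<Otimes>\<^sub>M borel)"
    by measurable
  moreover have "bad_set r i j n p = {z \<in> space (borel \<Otimes>\<^sub>M borel). fst z \<in> {0..1::real} \<and> snd z \<in> {0..1::real} \<and>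
     cell r (fst z) = i \<and> cell r (snd z) = j \<and> (cell p (real a ^ n * fst z) = 0 \<or> cell p (real a ^ n * snd z) = 0)}"
    by (auto simp: bad_set_def space_pair_measure)
  ultimately show ?thesis by (simp only: borel_prod)
qed

lemma sum_grid_cell:
  assumes "r \<le> m" "i < a ^ r"
  shows "(\<Sum>l<a ^ m. of_bool (cell r (grid m l) = i)) = real a ^ m / real a ^ r"
proof -
  have le: "a ^ r \<le> a ^ m" using assms base_ge_2 by (intro power_increasing) auto
  have "complex_of_real (\<Sum>l<a ^ m. of_bool (cell r (grid m l) = i)) =
     (\<Sum>l<a ^ m. \<Sum>k<a ^ r. cnj (walsh a k (grid r i)) / of_nat (a ^ r) * walsh a k (grid m l))"
  proof -
    have "complex_of_real (of_bool P) = of_bool P" for P by simp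
    then show ?thesis by (simp only: of_real_sum cell_indicator_expansion[OF assms(2)])
  qed
  also have "\<dots> = (\<Sum>k<a ^ r. cnj (walsh a k (grid r i)) / of_nat (a ^ r) * (\<Sum>l<a ^ m. walsh a k (grid m l)))"
    by (subst sum.swap) (simp only: sum_distrib_left)
  also have "\<dots> = (\<Sum>k<a ^ r. if k = 0 then of_nat (a ^ m) / of_nat (a ^ r) else 0)"
  proof (intro sum.cong refl)
    fix k assume "k \<in> {..<a ^ r}"
    then have "(\<Sum>l<a ^ m. walsh a k (grid m l)) = (if k = 0 then of_nat (a ^ m) else 0)"
      using walsh_orthogonal[of k m 0] le base_ge_2 by (simp add: walsh_0 grid_def)
    then show "cnj (walsh a k (grid r i)) / of_nat (a ^ r) * (\<Sum>l<a ^ m. walsh a k (grid m l)) =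
      (if k = 0 then of_nat (a ^ m) / of_nat (a ^ r) else 0)" by (simp add: walsh_0)
  qed
  also have "\<dots> = complex_of_real (real a ^ m / real a ^ r)"
    using base_ge_2 by simp
  finally show ?thesis by (simp only: of_real_eq_iff)
qed

text \<open>The bump has no constant term.\<close>

lemma sum_grid_bump:
  assumes "r \<le> n" "i < a ^ r"
  shows "(\<Sum>l<a ^ (n + p). bump r i n p (grid (n + p) l)) = 0"
proof -
  have "complex_of_real (\<Sum>l<a ^ (n + p). bump r i n p (grid (n + p) l)) =
    (\<Sum>\<kappa>\<in>{a ^ n..<a ^ (n + p)}. bump_coeff r i n \<kappa> * (\<Sum>l<a ^ (n + p). walsh a \<kappa> (grid (n + p) l)))"
    unfolding of_real_sum bump_expansion[OF assms] by (subst sum.swap) (simp only: sum_distrib_left)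
  also have "\<dots> = 0"
  proof (intro sum.neutral ballI)
    fix \<kappa> assume "\<kappa> \<in> {a ^ n..<a ^ (n + p)}"
    moreover have "a ^ n \<ge> 1" using base_ge_2 by simp
    ultimately have "\<kappa> < a ^ (n + p)" "\<kappa> \<noteq> 0" by auto
    then have "(\<Sum>l<a ^ (n + p). walsh a \<kappa> (grid (n + p) l)) = 0"
      using walsh_orthogonal[of \<kappa> "n + p" 0] base_ge_2 by (simp add: walsh_0 grid_def)
    then show "bump_coeff r i n \<kappa> * (\<Sum>l<a ^ (n + p). walsh a \<kappa> (grid (n + p) l)) = 0" by simp
  qed
  finally show ?thesis by (simp only: of_real_eq_0_iff)
qed

lemma cell_cong_le:
  assumes "cell m x = cell m y" "r \<le> m"
  shows "cell r x = cell r y"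
  using assms(2,1)
proof (induction rule: dec_induct)
  case (step k)
  have "cell (Suc k) z div a = cell k z" for z
    using adic_digit_less[of k z] by (simp add: cell_Suc)
  with step show ?case by metis
qed

lemma cell_scaled: "cell (n + p) x mod a ^ p = cell p (real a ^ n * x)"
proof (induction p)
  case 0
  have "real a ^ 0 * frac (real a ^ n * x) < 1" by (simp add: frac_lt_1)
  then show ?case by (simp add: cell_def floor_eq_iff nat_eq_iff)
next
  case (Suc p)
  have "adic_digit (n + p) x = adic_digit p (real a ^ n * x)"
    by (simp add: adic_digit_def power_add mult_ac)
  moreover have "(a * c + d) mod a ^ Suc p = a * (c mod a ^ p) + d" if "d < a" for c d
    using that base_ge_2 by (simp add: mod_mult2_eq)
  ultimately show ?case using Suc adic_digit_less by (simp add: cell_Suc)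
qed

text \<open>The share of the grid points of a cell at which the \<open>p\<close> digits after position \<open>n\<close> vanish is read off from
the fact that the bump averages to zero.\<close>

lemma emeasure_bad_set:
  assumes "r \<le> n" "i < a ^ r" "j < a ^ r"
  shows "emeasure (lebesgue_on unit_square) (bad_set r i j n p) \<le> ennreal (2 / ((real a ^ r)\<^sup>2 * real a ^ p))"
proof -
  define m where "m = n + p"
  define u where "u i x = (of_bool (cell r x = i) :: real)" for i x
  define v where "v i x = u i x * of_bool (cell p (real a ^ n * x) = 0)" for i x
  let ?A = "real a ^ m"
  have A: "?A > 0" "real a ^ p > 0" "real a ^ r > 0" using base_ge_2 by simp_all
  have rm: "r \<le> m" using assms by (simp add: m_def)
  have us: "(\<Sum>l<a ^ m. u i (grid m l)) = ?A / real a ^ r" if "i < a ^ r" for i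
    unfolding u_def using rm that by (rule sum_grid_cell)
  have vs: "(\<Sum>l<a ^ m. v i (grid m l)) = ?A / real a ^ r / real a ^ p" if "i < a ^ r" for i
  proof -
    have "v i x = (u i x - bump r i n p x) / real a ^ p" for x
      using A by (simp add: v_def u_def bump_def spike_def field_simps)
    then have "(\<Sum>l<a ^ m. v i (grid m l)) = ((\<Sum>l<a ^ m. u i (grid m l)) - (\<Sum>l<a ^ m. bump r i n p (grid m l))) / real a ^ p"
      by (simp add: sum_subtractf sum_divide_distrib[symmetric])
    then show ?thesis using sum_grid_bump[OF assms(1) that] us[OF that] by (simp add: m_def)
  qed
  have uv: "0 \<le> u i x" "0 \<le> v i x" for i x by (simp_all add: u_def v_def)
  define I :: "real \<times> real \<Rightarrow> ennreal" where "I = (\<lambda>(x, y). of_bool (cell r x = i \<and> cell r y = j \<and>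
     (cell p (real a ^ n * x) = 0 \<or> cell p (real a ^ n * y) = 0)))"
  have sets: "bad_set r i j n p \<in> sets (lebesgue_on unit_square)"
    using bad_set_sets by (auto simp: sets_restrict_space_iff bad_set_def intro!: image_eqI[where x = "bad_set r i j n p"]
       simp: sets_restrict_space)
  have "emeasure (lebesgue_on unit_square) (bad_set r i j n p) = (\<integral>\<^sup>+z. indicator (bad_set r i j n p) z \<partial>lebesgue_on unit_square)"
    using sets by simp
  also have "\<dots> = (\<integral>\<^sup>+z. I z \<partial>lebesgue_on unit_square)"
    by (rule nn_integral_cong) (auto simp: I_def bad_set_def indicator_def)
  also have "\<dots> = (\<Sum>k<a ^ m. \<Sum>l<a ^ m. I (grid m k, grid m l) * ennreal (1 / ?A\<^sup>2))"
  proof (rule nn_integral_cells)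
    fix x y x' y' assume *: "cell m x = cell m x'" "cell m y = cell m y'"
    then have "cell r x = cell r x'" "cell r y = cell r y'"
      using cell_cong_le rm by blast+
    moreover have "cell p (real a ^ n * x) = cell p (real a ^ n * x')" "cell p (real a ^ n * y) = cell p (real a ^ n * y')"
      using * unfolding m_def cell_scaled[symmetric] by simp_all
    ultimately show "I (x, y) = I (x', y')" by (simp add: I_def)
  qed
  also have "\<dots> \<le> (\<Sum>k<a ^ m. \<Sum>l<a ^ m. ennreal ((v i (grid m k) * u j (grid m l) + u i (grid m k) * v j (grid m l)) * (1 / ?A\<^sup>2)))"
  proof (intro sum_mono)
    fix k l
    have "I (grid m k, grid m l) \<le> ennreal (v i (grid m k) * u j (grid m l) + u i (grid m k) * v j (grid m l))"
      by (auto simp: I_def u_def v_def of_bool_def ennreal_leI)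
    from mult_right_mono[OF this, of "ennreal (1 / ?A\<^sup>2)"]
    show "I (grid m k, grid m l) * ennreal (1 / ?A\<^sup>2) \<le>
      ennreal ((v i (grid m k) * u j (grid m l) + u i (grid m k) * v j (grid m l)) * (1 / ?A\<^sup>2))"
      by (subst ennreal_mult) (simp_all add: uv)
  qed
  also have "\<dots> = ennreal (\<Sum>k<a ^ m. \<Sum>l<a ^ m. (v i (grid m k) * u j (grid m l) + u i (grid m k) * v j (grid m l)) * (1 / ?A\<^sup>2))"
    by (simp add: sum_ennreal sum_nonneg u_def v_def)
  also have "(\<Sum>k<a ^ m. \<Sum>l<a ^ m. (v i (grid m k) * u j (grid m l) + u i (grid m k) * v j (grid m l)) * (1 / ?A\<^sup>2)) =
     ((\<Sum>k<a ^ m. v i (grid m k)) * (\<Sum>l<a ^ m. u j (grid m l)) + (\<Sum>k<a ^ m. u i (grid m k)) * (\<Sum>l<a ^ m. v j (grid m l))) * (1 / ?A\<^sup>2)"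
    unfolding sum_product by (simp only: sum.distrib[symmetric] sum_distrib_right)
  also have "\<dots> = 2 / ((real a ^ r)\<^sup>2 * real a ^ p)"
    unfolding us[OF assms(2)] us[OF assms(3)] vs[OF assms(2)] vs[OF assms(3)]
    using A by (simp add: field_simps power2_eq_square)
  finally show ?thesis .
qed

end

section \<open>Selecting a convergent subseries\<close>

text \<open>Suppose that every function is approximated by a finite sum of late terms whose partial sums are not much
larger than the function. Approximating the remainder again and again, with errors \<open>2\<^sup>-\<^sup>k\<close>, yields a set
of indices; the remainders are small after each round, and they stay small within a round since the partial sums
of that round are controlled by the remainder at its beginning.\<close>

lemma greedy_selection:
  fixes Q :: "nat \<Rightarrow> 'b \<Rightarrow> real"
  assumes Q: "\<And>i. integrable M (Q i)"
    and step: "\<And>f \<eta> N. integrable M f \<Longrightarrow> \<eta> > 0 \<Longrightarrow> \<exists>F. finite F \<and> F \<subseteq> {N..} \<and>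
      (\<integral>z. \<bar>f z - (\<Sum>i\<in>F. Q i z)\<bar> \<partial>M) \<le> \<eta> \<and>
      (\<forall>m. (\<integral>z. \<bar>\<Sum>i\<in>F \<inter> {..<m}. Q i z\<bar> \<partial>M) \<le> (\<integral>z. \<bar>f z\<bar> \<partial>M) + \<eta>)"
    and f: "integrable M f"
  shows "\<exists>I. (\<lambda>m. \<integral>z. \<bar>f z - (\<Sum>i\<in>I \<inter> {..<m}. Q i z)\<bar> \<partial>M) \<longlonglongrightarrow> 0"
proof -
  define R where "R S = (\<lambda>z. f z - (\<Sum>i\<in>S. Q i z))" for S
  define E where "E g = (\<integral>z. \<bar>g z\<bar> \<partial>M)" for g :: "'b \<Rightarrow> real"
  have Rint: "integrable M (R S)" for S
    unfolding R_def using Q f by auto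
  define good where "good S N k F \<longleftrightarrow> finite F \<and> F \<subseteq> {N..} \<and>
      E (\<lambda>z. R S z - (\<Sum>i\<in>F. Q i z)) \<le> (1/2) ^ k \<and>
      (\<forall>m. E (\<lambda>z. \<Sum>i\<in>F \<inter> {..<m}. Q i z) \<le> E (R S) + (1/2) ^ k)" for S k F and N :: nat
  define \<phi> where "\<phi> S N k = (SOME F. good S N k F)" for S N k
  have "\<exists>F. good S N k F" for S N k
    unfolding good_def E_def by (rule step[OF Rint]) simp
  then have "good S N k (\<phi> S N k)" for S N k
    unfolding \<phi>_def by (rule someI_ex)
  then have \<phi>: "finite (\<phi> S N k) \<and> \<phi> S N k \<subseteq> {N..} \<and>
      E (\<lambda>z. R S z - (\<Sum>i\<in>\<phi> S N k. Q i z)) \<le> (1/2) ^ k \<and>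
      (\<forall>m. E (\<lambda>z. \<Sum>i\<in>\<phi> S N k \<inter> {..<m}. Q i z) \<le> E (R S) + (1/2) ^ k)" for S N k
    unfolding good_def .
  \<comment> \<open>The sum of a finite set of naturals bounds its elements, so round \<open>k\<close> only adds indices beyond those
    already chosen; they also are at least \<open>k\<close>, so that the indices below \<open>m\<close> are settled after \<open>m\<close> rounds.\<close>
  define S where "S = rec_nat {} (\<lambda>k S. S \<union> \<phi> S (k + Suc (\<Sum>S)) k)"
  define F where "F k = \<phi> (S k) (k + Suc (\<Sum>(S k))) k" for k
  have S0: "S 0 = {}" and SSuc: "S (Suc k) = S k \<union> F k" for k
    by (simp_all add: S_def F_def)
  have Ffin: "finite (F k)" and Fge: "F k \<subseteq> {k + Suc (\<Sum>(S k))..}"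
    and Fapp: "E (\<lambda>z. R (S k) z - (\<Sum>i\<in>F k. Q i z)) \<le> (1/2) ^ k"
    and Fpart: "E (\<lambda>z. \<Sum>i\<in>F k \<inter> {..<m}. Q i z) \<le> E (R (S k)) + (1/2) ^ k" for k m
    using \<phi> by (simp_all add: F_def)
  have Sfin: "finite (S k)" for k by (induction k) (auto simp: S0 SSuc Ffin)
  have Sle: "i \<le> \<Sum>(S k)" if "i \<in> S k" for i k
    using member_le_sum[of i "S k" "\<lambda>i. i"] Sfin that by simp
  have disj: "S k \<inter> F k = {}" for k
    using Sle Fge by fastforce
  have R_Un: "R (A \<union> B) = (\<lambda>z. R A z - (\<Sum>i\<in>B. Q i z))" if "finite A" "finite B" "A \<inter> B = {}" for A B
    using that by (auto simp: R_def sum.union_disjoint)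
  have res: "E (R (S (Suc k))) \<le> (1/2) ^ k" for k
    using Fapp[of k] by (simp add: SSuc R_Un Sfin Ffin disj)
  have tri: "E (\<lambda>z. g z - h z) \<le> E g + E h" if "integrable M g" "integrable M h" for g h
  proof -
    have "E (\<lambda>z. g z - h z) \<le> (\<integral>z. \<bar>g z\<bar> + \<bar>h z\<bar> \<partial>M)"
      unfolding E_def using that by (intro integral_mono) auto
    also have "\<dots> = E g + E h" unfolding E_def using that by simp
    finally show ?thesis .
  qed
  \<comment> \<open>The cut at \<open>m\<close> either falls into the round that is being added, or before it, in which case that round has
    no effect.\<close>
  have part: "E (R (S (Suc (K + d)) \<inter> {..<m})) \<le> 3 * (1/2) ^ K" if "S (Suc K) \<subseteq> {..<m}" for K d m
  proof (induction d)
    case 0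
    have "S (Suc K) \<inter> {..<m} = S (Suc K)" using that by auto
    moreover have "(1/2) ^ K \<le> 3 * (1/2 :: real) ^ K" by (rule order.trans[OF _ mult_right_mono[of 1 3]]) auto
    ultimately show ?case using order.trans[OF res[of K]] by simp
  next
    case (Suc d)
    let ?k = "Suc (K + d)"
    show ?case
    proof (cases "S ?k \<subseteq> {..<m}")
      case True
      then have "S (Suc ?k) \<inter> {..<m} = S ?k \<union> (F ?k \<inter> {..<m})" by (auto simp: SSuc)
      then have "E (R (S (Suc ?k) \<inter> {..<m})) = E (\<lambda>z. R (S ?k) z - (\<Sum>i\<in>F ?k \<inter> {..<m}. Q i z))"
        using disj[of ?k] by (subst R_Un[symmetric]) (auto simp: Sfin Ffin)
      also have "\<dots> \<le> E (R (S ?k)) + E (\<lambda>z. \<Sum>i\<in>F ?k \<inter> {..<m}. Q i z)"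
        using Q by (intro tri Rint) auto
      also have "\<dots> \<le> 2 * E (R (S ?k)) + (1/2) ^ ?k"
        using Fpart[of ?k m] by simp
      also have "\<dots> \<le> 2 * (1/2) ^ (K + d) + (1/2) ^ ?k"
        using res[of "K + d"] by simp
      also have "\<dots> \<le> 3 * (1/2) ^ (K + d)" by simp
      also have "\<dots> \<le> 3 * (1/2) ^ K" by (intro mult_left_mono power_decreasing) auto
      finally show ?thesis by simp
    next
      case False
      then obtain i where "i \<in> S ?k" "i \<ge> m" by force
      then have "m \<le> \<Sum>(S ?k)" using Sle by (meson order.trans)
      then have "F ?k \<inter> {..<m} = {}" using Fge[of ?k] by fastforce
      then have "S (Suc ?k) \<inter> {..<m} = S ?k \<inter> {..<m}" by (auto simp: SSuc)
      then show ?thesis using Suc by simp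
    qed
  qed
  define I where "I = (\<Union>k. S k)"
  have Smono: "S k \<subseteq> S l" if "k \<le> l" for k l
    using that by (induction rule: dec_induct) (auto simp: SSuc)
  have "S (m + d) \<inter> {..<m} \<subseteq> S m" for m d
  proof (induction d)
    case (Suc d)
    have "F (m + d) \<inter> {..<m} = {}" using Fge[of "m + d"] by fastforce
    with Suc show ?case by (auto simp: SSuc)
  qed simp
  then have "S l \<inter> {..<m} \<subseteq> S m" for l m
    using Smono by (metis inf.coboundedI1 le_add_diff_inverse nat_le_linear)
  then have Im: "I \<inter> {..<m} = S m \<inter> {..<m}" for m
    by (auto simp: I_def)
  have "(\<lambda>m. E (R (I \<inter> {..<m}))) \<longlonglongrightarrow> 0"
  proof (rule LIMSEQ_I)
    fix e :: real assume "e > 0"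
    obtain K where K: "(1/2) ^ K < e / 3"
      using real_arch_pow_inv[of "e / 3" "1/2"] \<open>e > 0\<close> by auto
    obtain m0 where m0: "S (Suc K) \<subseteq> {..<m0}"
      using Sfin finite_nat_iff_bounded by blast
    have "norm (E (R (I \<inter> {..<m})) - 0) < e" if m: "m \<ge> max m0 (Suc K)" for m
    proof -
      obtain d where d: "m = Suc (K + d)" using m by (metis le_Suc_ex max.boundedE add_Suc)
      have "S (Suc K) \<subseteq> {..<m}" using m0 m by auto
      then have "E (R (I \<inter> {..<m})) \<le> 3 * (1/2) ^ K"
        unfolding Im using part[of K m d] d by simp
      moreover have "E (R (I \<inter> {..<m})) \<ge> 0" unfolding E_def by simp
      ultimately show ?thesis using K by simp
    qed
    then show "\<exists>m0. \<forall>m\<ge>m0. norm (E (R (I \<inter> {..<m})) - 0) < e" by blast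
  qed
  then show ?thesis unfolding E_def R_def by blast
qed

text \<open>A measurable function is almost everywhere the limit of continuous functions. Truncation at
a level \<open>K\<close> makes dominated convergence applicable, first to the truncations of \<open>f\<close>, then to the truncated
continuous functions.\<close>

lemma continuous_dense_L1:
  fixes f :: "'a::euclidean_space \<Rightarrow> real"
  assumes S: "S \<in> sets lebesgue" and sets: "sets M = sets (lebesgue_on S)"
    and M: "finite_measure M" "absolutely_continuous (lebesgue_on S) M"
    and f: "integrable M f" and \<eta>: "\<eta> > 0"
  shows "\<exists>g. continuous_on UNIV g \<and> integrable M g \<and> (\<integral>z. \<bar>f z - g z\<bar> \<partial>M) < \<eta>"
proof -
  interpret finite_measure M by (rule M)
  define clamp where "clamp K t = max (- real K) (min (real K) t)" for K t
  have space: "space M = S"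
    using sets_eq_imp_space_eq[OF sets] by simp
  have fS: "f \<in> borel_measurable (lebesgue_on S)"
    using borel_measurable_integrable[OF f] measurable_cong_sets[OF sets refl] by blast
  then have "f measurable_on S"
    using S by (simp add: measurable_on_iff_borel_measurable)
  then obtain N h where N: "negligible N" and h: "\<And>n. continuous_on UNIV (h n)"
    and lim: "\<And>x. x \<notin> N \<Longrightarrow> (\<lambda>n. h n x) \<longlonglongrightarrow> (if x \<in> S then f x else 0)"
    unfolding measurable_on_def by blast
  have "AE x in lebesgue. x \<notin> N"
    using N by (intro AE_not_in) (simp add: negligible_iff_null_sets)
  then have "AE x in lebesgue_on S. x \<notin> N"
    using S by (auto simp: AE_restrict_space_iff elim: eventually_mono)
  then have AEN: "AE x in M. x \<notin> N"
    by (rule absolutely_continuous_AE[OF sets M(2)])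
  have hM: "h n \<in> borel_measurable M" for n
  proof -
    have "h n \<in> borel_measurable lebesgue" using h[of n] 
      by (intro measurable_completion) (simp add: borel_measurable_continuous_onI)
    then have "h n \<in> borel_measurable (lebesgue_on S)" by (rule measurable_restrict_space1)
    then show ?thesis using measurable_cong_sets[OF sets refl] by blast
  qed
  have clamp_cont: "continuous_on UNIV (\<lambda>x. clamp K (g x))" if "continuous_on UNIV g" for K and g :: "'a \<Rightarrow> real"
    unfolding clamp_def by (intro continuous_intros that)
  have clampM: "(\<lambda>x. clamp K (g x)) \<in> borel_measurable M" if "g \<in> borel_measurable M" for K g
    unfolding clamp_def using that by measurable
  have clamp_int: "integrable M (\<lambda>x. clamp K (g x))" if "g \<in> borel_measurable M" for K g
    by (rule integrable_const_bound[where B = "real K"]) (use clampM[OF that] in \<open>auto simp: clamp_def\<close>)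
  have "(\<lambda>K. \<integral>z. \<bar>f z - clamp K (f z)\<bar> \<partial>M) \<longlonglongrightarrow> (\<integral>z. 0 \<partial>M)"
  proof (rule integral_dominated_convergence[where w = "\<lambda>z. \<bar>f z\<bar>"])
    show "AE x in M. (\<lambda>K. \<bar>f x - clamp K (f x)\<bar>) \<longlonglongrightarrow> 0"
    proof (rule AE_I2)
      fix x
      obtain K0 where "\<bar>f x\<bar> \<le> real K0" using real_arch_simple by blast
      then have "\<bar>f x - clamp K (f x)\<bar> = 0" if "K \<ge> K0" for K
        using that by (auto simp: clamp_def)
      then show "(\<lambda>K. \<bar>f x - clamp K (f x)\<bar>) \<longlonglongrightarrow> 0"
        by (intro tendsto_eventually) (auto simp: eventually_sequentially)
    qed
    show "AE x in M. norm \<bar>f x - clamp K (f x)\<bar> \<le> \<bar>f x\<bar>" for K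
      by (auto simp: clamp_def)
  qed (use f clampM in auto)
  then have "\<forall>\<^sub>F K in sequentially. (\<integral>z. \<bar>f z - clamp K (f z)\<bar> \<partial>M) < \<eta> / 2"
    using \<eta> by (intro order_tendstoD) auto
  then obtain K where K: "(\<integral>z. \<bar>f z - clamp K (f z)\<bar> \<partial>M) < \<eta> / 2"
    by (auto simp: eventually_sequentially)
  have "(\<lambda>n. \<integral>z. \<bar>clamp K (f z) - clamp K (h n z)\<bar> \<partial>M) \<longlonglongrightarrow> (\<integral>z. 0 \<partial>M)"
  proof (rule integral_dominated_convergence[where w = "\<lambda>z. 2 * real K"])
    show "AE x in M. (\<lambda>n. \<bar>clamp K (f x) - clamp K (h n x)\<bar>) \<longlonglongrightarrow> 0"
      using AEN AE_space
    proof eventually_elim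
      case (elim x)
      then have "(\<lambda>n. h n x) \<longlonglongrightarrow> f x" using lim[of x] by (simp add: space)
      then have "(\<lambda>n. \<bar>clamp K (f x) - clamp K (h n x)\<bar>) \<longlonglongrightarrow> \<bar>clamp K (f x) - clamp K (f x)\<bar>"
        unfolding clamp_def by (intro tendsto_intros)
      then show ?case by simp
    qed
    show "AE x in M. norm \<bar>clamp K (f x) - clamp K (h n x)\<bar> \<le> 2 * real K" for n
      by (auto simp: clamp_def)
  qed (use f clampM hM in auto)
  then have "\<forall>\<^sub>F n in sequentially. (\<integral>z. \<bar>clamp K (f z) - clamp K (h n z)\<bar> \<partial>M) < \<eta> / 2"
    using \<eta> by (intro order_tendstoD) auto
  then obtain n where n: "(\<integral>z. \<bar>clamp K (f z) - clamp K (h n z)\<bar> \<partial>M) < \<eta> / 2"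
    by (auto simp: eventually_sequentially)
  let ?g = "\<lambda>z. clamp K (h n z)"
  have fM: "f \<in> borel_measurable M" using f by simp
  have ints: "integrable M ?g" "integrable M (\<lambda>z. clamp K (f z))"
    using clamp_int hM fM by blast+
  have "(\<integral>z. \<bar>f z - ?g z\<bar> \<partial>M) \<le> (\<integral>z. \<bar>f z - clamp K (f z)\<bar> + \<bar>clamp K (f z) - ?g z\<bar> \<partial>M)"
    using f ints by (intro integral_mono) auto
  also have "\<dots> = (\<integral>z. \<bar>f z - clamp K (f z)\<bar> \<partial>M) + (\<integral>z. \<bar>clamp K (f z) - ?g z\<bar> \<partial>M)"
    using f ints by (intro Bochner_Integration.integral_add) auto
  also have "\<dots> < \<eta>" using K n by simp
  finally show ?thesis using clamp_cont[OF h[of n]] ints(1) by blast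
qed

section \<open>Weights\<close>

text \<open>At points where the sum diverges, \<open>enn2real\<close> makes the weight 1 instead of 0, so that it is
positive everywhere; if the sets have summable measure, these points form a null set.\<close>

definition weight :: "(nat \<Rightarrow> real) \<Rightarrow> (nat \<Rightarrow> 'b set) \<Rightarrow> nat \<Rightarrow> 'b \<Rightarrow> real" where
  "weight K B i0 z = 1 / (1 + enn2real (\<Sum>i. ennreal (K (i + i0)) * indicator (B (i + i0)) z))"

lemma weight_pos_le_1: "0 < weight K B i0 z \<and> weight K B i0 z \<le> 1"
  using enn2real_nonneg[of "\<Sum>i. ennreal (K (i + i0)) * indicator (B (i + i0)) z"]
  by (simp add: weight_def add_pos_nonneg)

lemma weight_measurable:
  assumes [measurable]: "\<And>i. B i \<in> sets M"
  shows "weight K B i0 \<in> borel_measurable M"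
  unfolding weight_def by measurable

lemma weight_neq_1: "weight K B i0 z \<noteq> 1 \<Longrightarrow> \<exists>i\<ge>i0. z \<in> B i"
proof (rule ccontr)
  assume "weight K B i0 z \<noteq> 1" "\<not> (\<exists>i\<ge>i0. z \<in> B i)"
  then have "(\<lambda>i. ennreal (K (i + i0)) * indicator (B (i + i0)) z) = (\<lambda>i. 0)"
    by (auto simp: indicator_def)
  then have "weight K B i0 z = 1" by (simp add: weight_def)
  with \<open>weight K B i0 z \<noteq> 1\<close> show False by simp
qed

text \<open>By the Borel-Cantelli lemma almost every point lies in finitely many of the sets, where the sum is a
genuine finite number that is not smaller than any of its terms.\<close>

lemma weight_le:
  assumes B: "\<And>i. B i \<in> sets M" "\<And>i. emeasure M (B i) < \<infinity>" "summable (\<lambda>i. measure M (B i))"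
    and K: "\<And>i. K i \<ge> 0"
  shows "AE z in M. \<forall>i\<ge>i0. z \<in> B i \<longrightarrow> weight K B i0 z \<le> 1 / (1 + K i)"
  using borel_cantelli_AE1[OF B]
proof eventually_elim
  case (elim z)
  define t where "t i = ennreal (K (i + i0)) * indicator (B (i + i0)) z" for i
  obtain n where n: "\<And>i. i \<ge> n \<Longrightarrow> z \<notin> B i" using elim by (auto simp: eventually_sequentially)
  then have "suminf t = (\<Sum>i<n. t i)"
    by (intro suminf_finite) (auto simp: t_def indicator_def)
  also have "\<dots> < \<infinity>" by (auto simp: t_def indicator_def ennreal_mult_less_top)
  finally have fin: "suminf t < \<infinity>" .
  show ?case
  proof (intro allI impI)
    fix i assume i: "i \<ge> i0" "z \<in> B i"
    then have "ennreal (K i) = t (i - i0)" by (simp add: t_def)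
    also have "\<dots> \<le> suminf t"
      using sum_le_suminf[of t "{i - i0}"] by simp
    finally have "K i \<le> enn2real (suminf t)"
      using fin K[of i] by (metis enn2real_ennreal enn2real_mono infinity_ennreal_def)
    then show "weight K B i0 z \<le> 1 / (1 + K i)"
      using K[of i] unfolding weight_def t_def[symmetric] by (intro divide_left_mono) auto
  qed
qed

section \<open>The universal series\<close>

context adic_base
begin

text \<open>A quadruple \<open>(s, k, i, j)\<close> stands for a block of stage \<open>s\<close> over the square with coordinates \<open>(i, j)\<close> of rank \<open>s\<^sup>2\<close>;
the number \<open>k\<close> encodes the height of the block, see \<open>stage_height\<close>.\<close>

definition pieces :: "(nat \<times> nat \<times> nat \<times> nat) set" where
  "pieces = (SIGMA s:UNIV. {..2 * a ^ (2 * s)} \<times> {..<a ^ (s * s)} \<times> {..<a ^ (s * s)})"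

definition piece :: "nat \<Rightarrow> nat \<times> nat \<times> nat \<times> nat" where
  "piece = from_nat_into pieces"

definition stage :: "nat \<Rightarrow> nat" where "stage l = fst (piece l)"
definition row :: "nat \<Rightarrow> nat" where "row l = fst (snd (snd (piece l)))"
definition col :: "nat \<Rightarrow> nat" where "col l = snd (snd (snd (piece l)))"

text \<open>As \<open>k\<close> runs from 0 to \<open>2 a\<^sup>2\<^sup>s\<close>, this runs through \<open>[-a\<^sup>s, a\<^sup>s]\<close> in steps of \<open>a\<^sup>-\<^sup>s\<close>.\<close>

definition stage_height :: "nat \<Rightarrow> nat \<Rightarrow> real" where
  "stage_height s k = (real k - real a ^ (2 * s)) / real a ^ s"

definition height :: "nat \<Rightarrow> real" where
  "height l = stage_height (stage l) (fst (snd (piece l)))"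

text \<open>The frequencies of block \<open>l\<close> range from \<open>a\<close> to the power \<open>offset l\<close> up to \<open>a\<close> to the power
\<open>offset l + 3 * stage l\<close>. The summands keep the blocks apart and make the offset at least
the rank of the square, as the expansion of a block requires.\<close>

definition offset :: "nat \<Rightarrow> nat" where
  "offset l = stage l * stage l + (\<Sum>h<l. 3 * stage h + stage h * stage h)"

lemma bij_piece: "bij_betw piece UNIV pieces"
proof -
  have "countable pieces" by simp
  moreover have "infinite pieces"
  proof
    assume "finite pieces"
    moreover have "s \<in> fst ` pieces" for s
      using base_ge_2 by (intro image_eqI[of _ _ "(s, 0, 0, 0)"]) (auto simp: pieces_def)
    ultimately have "finite (UNIV :: nat set)"
      by (metis finite_imageI rev_finite_subset subsetI)
    then show False by simp
  qed
  ultimately show ?thesis unfolding piece_def by (rule bij_betw_from_nat_into)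
qed

lemma piece_in: "piece l \<in> pieces"
  using bij_piece by (auto simp: bij_betw_def)

lemma row_less: "row l < a ^ (stage l * stage l)" and col_less: "col l < a ^ (stage l * stage l)"
  using piece_in[of l] by (auto simp: pieces_def row_def col_def stage_def)

lemma abs_stage_height_le: "k \<le> 2 * a ^ (2 * s) \<Longrightarrow> \<bar>stage_height s k\<bar> \<le> real a ^ s"
proof -
  assume "k \<le> 2 * a ^ (2 * s)"
  then have "real k \<le> 2 * real a ^ (2 * s)" by (metis of_nat_le_iff of_nat_mult of_nat_numeral of_nat_power)
  then have "\<bar>real k - real a ^ (2 * s)\<bar> \<le> real a ^ (2 * s)" by linarith
  also have "\<dots> = real a ^ s * real a ^ s" by (simp add: mult_2 power_add)
  finally show ?thesis using base_ge_2 by (simp add: stage_height_def abs_divide divide_le_eq)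
qed

lemma abs_height_le: "\<bar>height l\<bar> \<le> real a ^ stage l"
  unfolding height_def
  using piece_in[of l] by (intro abs_stage_height_le) (auto simp: pieces_def stage_def)

lemma stage_le_offset: "stage l * stage l \<le> offset l"
  by (simp add: offset_def)

lemma offset_separated: "h < l \<Longrightarrow> offset h + 3 * stage h \<le> offset l"
proof -
  assume "h < l"
  then have "(\<Sum>h'<Suc h. 3 * stage h' + stage h' * stage h') \<le> (\<Sum>h'<l. 3 * stage h' + stage h' * stage h')"
    by (intro sum_mono2) auto
  then show ?thesis by (simp add: offset_def)
qed

lemma piece_stage_subset:
  "piece ` {l. stage l = s} \<subseteq> {s} \<times> {..2 * a ^ (2 * s)} \<times> {..<a ^ (s * s)} \<times> {..<a ^ (s * s)}"
proof (rule image_subsetI)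
  fix l assume "l \<in> {l. stage l = s}"
  then show "piece l \<in> {s} \<times> {..2 * a ^ (2 * s)} \<times> {..<a ^ (s * s)} \<times> {..<a ^ (s * s)}"
    using piece_in[of l] by (cases "piece l") (auto simp: stage_def pieces_def)
qed

lemma finite_stage: "finite {l. stage l = s}"
proof -
  have "inj piece" using bij_piece by (auto simp: bij_betw_def)
  moreover have "finite (piece ` {l. stage l = s})"
    using piece_stage_subset by (rule finite_subset) simp
  ultimately show ?thesis by (metis finite_imageD inj_on_subset subset_UNIV)
qed

lemma stage_tendsto: "filterlim stage at_top sequentially"
proof (subst filterlim_at_top, rule allI)
  fix S
  have "finite (\<Union>s<S. {l. stage l = s})" by (simp add: finite_stage)
  moreover have "(\<Union>s<S. {l. stage l = s}) = {l. \<not> S \<le> stage l}" by auto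
  ultimately show "\<forall>\<^sub>F l in sequentially. S \<le> stage l"
    by (simp add: cofinite_eq_sequentially[symmetric] eventually_cofinite)
qed

text \<open>A stage contains at most \<open>3 a\<^sup>2\<^sup>s (a\<^bsup>s s\<^esup>)\<^sup>2\<close> pieces, and for nonnegative terms the order of the enumeration is
irrelevant.\<close>

lemma summable_over_pieces:
  fixes w :: "nat \<Rightarrow> real"
  assumes w: "\<And>l. 0 \<le> w l" "\<And>l. w l \<le> v (stage l)"
    and v: "\<And>s. 0 \<le> v s" "summable (\<lambda>s. 3 * real a ^ (2 * s) * (real a ^ (s * s))\<^sup>2 * v s)"
  shows "summable w"
proof (rule summableI_nonneg_bounded)
  let ?b = "\<lambda>s. 3 * real a ^ (2 * s) * (real a ^ (s * s))\<^sup>2 * v s"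
  fix n
  obtain S where S: "\<And>l. l < n \<Longrightarrow> stage l < S"
  proof
    show "stage l < Suc (Max (stage ` {..<n}))" if "l < n" for l
      using that by (simp add: less_Suc_eq_le)
  qed
  have card: "real (card {l. stage l = s}) \<le> 3 * real a ^ (2 * s) * (real a ^ (s * s))\<^sup>2" for s
  proof -
    let ?T = "{s} \<times> {..2 * a ^ (2 * s)} \<times> {..<a ^ (s * s)} \<times> {..<a ^ (s * s)}"
    have "inj_on piece {l. stage l = s}" using bij_piece by (auto simp: bij_betw_def inj_on_def)
    then have "card {l. stage l = s} \<le> card ?T"
      by (rule card_inj_on_le[OF _ piece_stage_subset]) simp
    also have "card ?T = (2 * a ^ (2 * s) + 1) * (a ^ (s * s) * a ^ (s * s))" by simp
    also have "\<dots> \<le> (3 * a ^ (2 * s)) * (a ^ (s * s) * a ^ (s * s))"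
      using base_ge_2 by (intro mult_right_mono) auto
    finally have "real (card {l. stage l = s}) \<le> real ((3 * a ^ (2 * s)) * (a ^ (s * s) * a ^ (s * s)))"
      by (simp only: of_nat_le_iff)
    then show ?thesis by (simp add: power2_eq_square)
  qed
  have "(\<Sum>l<n. w l) \<le> (\<Sum>l\<in>(\<Union>s<S. {l. stage l = s}). w l)"
    using w S by (intro sum_mono2) (auto simp: finite_stage)
  also have "\<dots> = (\<Sum>s<S. \<Sum>l\<in>{l. stage l = s}. w l)"
    by (rule sum.UNION_disjoint) (auto simp: finite_stage)
  also have "\<dots> \<le> (\<Sum>s<S. ?b s)"
  proof (rule sum_mono)
    fix s
    have "(\<Sum>l\<in>{l. stage l = s}. w l) \<le> (\<Sum>l\<in>{l. stage l = s}. v s)"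
      using w(2) by (intro sum_mono) auto
    also have "\<dots> = real (card {l. stage l = s}) * v s" by simp
    also have "\<dots> \<le> ?b s" using card v(1) by (rule mult_right_mono)
    finally show "(\<Sum>l\<in>{l. stage l = s}. w l) \<le> ?b s" .
  qed
  also have "\<dots> \<le> suminf ?b"
    using v base_ge_2 by (intro sum_le_suminf) auto
  finally show "(\<Sum>l<n. w l) \<le> suminf ?b" .
qed (rule w)

abbreviation spectrum where
  "spectrum l \<equiv> frequencies (offset l) (3 * stage l)"
abbreviation piece_coeff where
  "piece_coeff l \<equiv> block_coeff (height l) (stage l * stage l) (row l) (col l) (offset l)"
abbreviation piece_poly where
  "piece_poly l \<equiv> block (height l) (stage l * stage l) (row l) (col l) (offset l) (3 * stage l)"
abbreviation piece_step where
  "piece_step l \<equiv> square_step (height l) (stage l * stage l) (row l) (col l)"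
abbreviation piece_bad where
  "piece_bad l \<equiv> bad_set (stage l * stage l) (row l) (col l) (offset l) (3 * stage l)"

text \<open>The sum has at most one term, because the spectra are disjoint.\<close>

definition series_coeff :: "nat \<Rightarrow> nat \<Rightarrow> complex" where
  "series_coeff k \<nu> = (\<Sum>l | (k, \<nu>) \<in> spectrum l. piece_coeff l (k, \<nu>))"

lemma finite_spectrum: "finite (spectrum l)"
  by (simp add: frequencies_def)

lemma spectrum_disjoint: "h \<noteq> l \<Longrightarrow> spectrum h \<inter> spectrum l = {}"
proof -
  have *: "spectrum h \<inter> spectrum l = {}" if "h < l" for h l
  proof -
    have "a ^ (offset h + 3 * stage h) \<le> a ^ offset l"
      using base_ge_2 offset_separated[OF that] by (intro power_increasing) auto
    then show ?thesis by (auto simp: frequencies_def)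
  qed
  assume "h \<noteq> l"
  then show ?thesis using *[of h l] *[of l h] by (metis Int_commute nat_neq_iff)
qed

lemma series_coeff_spectrum:
  assumes "(k, \<nu>) \<in> spectrum l"
  shows "series_coeff k \<nu> = piece_coeff l (k, \<nu>)"
proof -
  have "{h. (k, \<nu>) \<in> spectrum h} = {l}" using assms spectrum_disjoint by blast
  then show ?thesis by (simp add: series_coeff_def)
qed

text \<open>The squares of one rank have total area 1, so that the bad sets of stage \<open>s\<close> have total measure
at most a constant times \<open>a\<^sup>2\<^sup>s\<close>, the number of heights, times \<open>a\<^sup>-\<^sup>3\<^sup>s\<close>.\<close>

lemma summable_bad_sets:
  "summable (\<lambda>l. measure (lebesgue_on unit_square) (piece_bad l))"
proof (rule summable_over_pieces)
  let ?v = "\<lambda>s. 2 / ((real a ^ (s * s))\<^sup>2 * real a ^ (3 * s))"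
  show "measure (lebesgue_on unit_square) (piece_bad l) \<le> ?v (stage l)" for l
  proof -
    have "emeasure (lebesgue_on unit_square) (piece_bad l) \<le> ennreal (?v (stage l))"
      by (rule emeasure_bad_set[OF stage_le_offset row_less col_less])
    then show ?thesis by (simp add: measure_def enn2real_leI)
  qed
  have "3 * real a ^ (2 * s) * (real a ^ (s * s))\<^sup>2 * ?v s = 6 * (1 / real a) ^ s" for s
  proof -
    have "real a ^ (3 * s) = real a ^ (2 * s) * real a ^ s" by (simp flip: power_add)
    then show ?thesis using base_ge_2 by (simp add: field_simps power_one_over)
  qed
  then show "summable (\<lambda>s. 3 * real a ^ (2 * s) * (real a ^ (s * s))\<^sup>2 * ?v s)"
    using base_ge_2 by (simp add: summable_mult summable_geometric)
qed auto

text \<open>Stage \<open>s\<close> contributes at most \<open>3 a\<^bsup>e\<^esup>\<close> with \<open>e = s (8 + q) - 2 s\<^sup>2 (q - 2)\<close>, and for \<open>q > 2\<close> the quadratic term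
wins.\<close>

lemma summable_coefficients:
  assumes q: "q > 2"
  shows "summable (\<lambda>l. \<Sum>z\<in>spectrum l. norm (piece_coeff l z) powr q)"
proof (rule summable_over_pieces)
  let ?v = "\<lambda>s. (real a ^ s / (real a ^ (s * s))\<^sup>2) powr q * (real a ^ (3 * s) * real a ^ (s * s))\<^sup>2"
  show "(\<Sum>z\<in>spectrum l. norm (piece_coeff l z) powr q) \<le> ?v (stage l)" for l
  proof -
    have "1 \<le> real a ^ (3 * stage l)" using base_ge_2 by simp
    then have "((real a ^ (3 * stage l) - 1) * real a ^ (stage l * stage l))\<^sup>2 \<le>
       (real a ^ (3 * stage l) * real a ^ (stage l * stage l))\<^sup>2"
      by (intro power_mono mult_right_mono) auto
    moreover have "(\<bar>height l\<bar> / (real a ^ (stage l * stage l))\<^sup>2) powr q \<le>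
       (real a ^ stage l / (real a ^ (stage l * stage l))\<^sup>2) powr q"
      using abs_height_le q by (intro powr_mono2 divide_right_mono) auto
    ultimately show ?thesis
      using q by (subst block_coeff_sum[OF stage_le_offset]) (auto intro: mult_mono)
  qed
  have pw: "real a ^ n = real a powr real n" for n using base_ge_2 by (simp add: powr_realpow)
  have eq: "3 * real a ^ (2 * s) * (real a ^ (s * s))\<^sup>2 * ?v s =
     3 * real a powr (real s * ((8 + q) - 2 * real s * (q - 2)))" for s
    unfolding pw power2_eq_square
    using base_ge_2 by (simp add: powr_powr algebra_simps flip: powr_add powr_diff)
  show "summable (\<lambda>s. 3 * real a ^ (2 * s) * (real a ^ (s * s))\<^sup>2 * ?v s)"
  proof (rule summable_comparison_test)
    \<comment> \<open>From this stage on the exponent is at most \<open>-s\<close>.\<close>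
    obtain s0 :: nat where s0: "(9 + q) / (2 * (q - 2)) \<le> real s0" using real_arch_simple by blast
    have "norm (3 * real a ^ (2 * s) * (real a ^ (s * s))\<^sup>2 * ?v s) \<le> 3 * (1 / real a) ^ s" if "s \<ge> s0" for s
    proof -
      have "(9 + q) / (2 * (q - 2)) \<le> real s" using s0 that by linarith
      then have "9 + q \<le> real s * (2 * (q - 2))" using q by (subst (asm) pos_divide_le_eq) auto
      then have "(8 + q) - 2 * real s * (q - 2) \<le> -1" by (simp add: algebra_simps)
      then have "real s * ((8 + q) - 2 * real s * (q - 2)) \<le> real s * -1" by (intro mult_left_mono) auto
      then have "real a powr (real s * ((8 + q) - 2 * real s * (q - 2))) \<le> real a powr (- real s)"
        using base_ge_2 by (intro powr_mono) auto
      also have "\<dots> = (1 / real a) ^ s" using base_ge_2 by (simp add: powr_minus powr_realpow power_one_over inverse_eq_divide)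
      finally show ?thesis unfolding eq by simp
    qed
    then show "\<exists>N. \<forall>s\<ge>N. norm (3 * real a ^ (2 * s) * (real a ^ (s * s))\<^sup>2 * ?v s) \<le> 3 * (1 / real a) ^ s" by blast
    show "summable (\<lambda>s. 3 * (1 / real a) ^ s)"
      using base_ge_2 by (simp add: summable_mult summable_geometric)
  qed
qed (auto intro: sum_nonneg)

lemma series_coeff_summable:
  assumes q: "q > 2"
  shows "(\<lambda>(k, \<nu>). norm (series_coeff k \<nu>) powr q) summable_on {1..} \<times> {1..}"
proof (rule nonneg_bdd_above_summable_on)
  let ?f = "\<lambda>(k, \<nu>). norm (series_coeff k \<nu>) powr q"
  let ?g = "\<lambda>l. \<Sum>z\<in>spectrum l. norm (piece_coeff l z) powr q"
  show "?f z \<ge> 0" for z by (auto split: prod.splits)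
  have "sum ?f F \<le> suminf ?g" if "finite F" for F
  proof -
    define F' where "F' = {z\<in>F. \<exists>l. z \<in> spectrum l}"
    define idx where "idx z = (SOME l. z \<in> spectrum l)" for z
    have idx: "z \<in> spectrum (idx z)" if "z \<in> F'" for z
      using that unfolding F'_def idx_def by (auto intro: someI)
    have "finite F'" using that by (simp add: F'_def)
    then obtain n where n: "idx ` F' \<subseteq> {..<n}" using finite_nat_iff_bounded by blast
    have "sum ?f F = sum ?f F'"
      using that by (intro sum.mono_neutral_right) (auto simp: F'_def series_coeff_def)
    also have "\<dots> \<le> sum ?f (\<Union>l<n. spectrum l)"
      using n idx by (intro sum_mono2) (auto simp: finite_spectrum)
    also have "\<dots> = (\<Sum>l<n. \<Sum>z\<in>spectrum l. ?f z)"
      by (rule sum.UNION_disjoint) (auto simp: finite_spectrum dest: spectrum_disjoint)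
    also have "\<dots> = (\<Sum>l<n. ?g l)"
      by (intro sum.cong refl) (auto simp: series_coeff_spectrum)
    also have "\<dots> \<le> suminf ?g"
      by (intro sum_le_suminf summable_coefficients q) (auto intro: sum_nonneg)
    finally show ?thesis .
  qed
  then show "bdd_above (sum ?f ` {F. F \<subseteq> {1..} \<times> {1..} \<and> finite F})"
    by (auto simp: bdd_above_def)
qed

definition partial_bound :: "nat \<Rightarrow> real" where
  "partial_bound l = \<bar>height l\<bar> * real a ^ (3 * stage l) / real a ^ (stage l * stage l)"

lemma partial_bound_tendsto: "partial_bound \<longlonglongrightarrow> 0"
proof (rule tendsto_sandwich)
  show "\<forall>\<^sub>F l in sequentially. 0 \<le> partial_bound l" by (simp add: partial_bound_def)
  have "partial_bound l \<le> (1 / real a) ^ stage l" if "stage l \<ge> 5" for l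
  proof -
    have "5 * stage l \<le> stage l * stage l" using that by (rule mult_right_mono) simp
    then have "real a ^ (5 * stage l) \<le> real a ^ (stage l * stage l)" using base_ge_2 by (intro power_increasing) auto
    moreover have "partial_bound l \<le> real a ^ stage l * real a ^ (3 * stage l) / real a ^ (stage l * stage l)"
      unfolding partial_bound_def using abs_height_le by (intro divide_right_mono mult_right_mono) auto
    ultimately have "partial_bound l \<le> real a ^ stage l * real a ^ (3 * stage l) / real a ^ (5 * stage l)"
      using base_ge_2 by (elim order.trans) (intro divide_left_mono, auto)
    also have "real a ^ (5 * stage l) = real a ^ stage l * real a ^ (3 * stage l) * real a ^ stage l"
      by (simp flip: power_add)
    finally show ?thesis using base_ge_2 by (simp add: power_one_over)
  qed
  moreover have "\<forall>\<^sub>F l in sequentially. stage l \<ge> 5"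
    using stage_tendsto by (simp add: filterlim_at_top)
  ultimately show "\<forall>\<^sub>F l in sequentially. partial_bound l \<le> (1 / real a) ^ stage l"
    by (auto elim: eventually_mono)
  have "(\<lambda>s. (1 / real a) ^ s) \<longlonglongrightarrow> 0" using base_ge_2 by (intro LIMSEQ_power_zero) simp
  then show "(\<lambda>l. (1 / real a) ^ stage l) \<longlonglongrightarrow> 0"
    using stage_tendsto by (rule filterlim_compose)
qed simp

end

section \<open>Approximation in the weighted norm\<close>

lemma sum_half_powers_le:
  assumes "finite F" "F \<subseteq> {N..}"
  shows "(\<Sum>l\<in>F. (1/2::real) ^ l) \<le> 2 * (1/2) ^ N"
proof -
  obtain n where n: "F \<subseteq> {..<N + n}"
    using assms(1) by (metis finite_nat_iff_bounded lessThan_subset_iff le_add2 order.trans)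
  have "(\<Sum>l\<in>{N..<N + n}. (1/2::real) ^ l) = 2 * (1/2) ^ N - 2 * (1/2) ^ (N + n)"
    by (induction n) simp_all
  moreover have "(\<Sum>l\<in>F. (1/2::real) ^ l) \<le> (\<Sum>l\<in>{N..<N + n}. (1/2) ^ l)"
    using n assms by (intro sum_mono2) auto
  moreover have "(0::real) \<le> (1/2) ^ (N + n)" by simp
  ultimately show ?thesis by linarith
qed

context adic_base
begin

lemma emeasure_unit_square: "emeasure (lebesgue_on unit_square) (space (lebesgue_on unit_square)) = 1"
proof -
  have "emeasure (lebesgue_on unit_square) (space (lebesgue_on unit_square)) = (\<integral>\<^sup>+z. 1 \<partial>lebesgue_on unit_square)"
    by (simp only: nn_integral_const mult_1)
  also have "\<dots> = 1" by (subst nn_integral_cells[of 0]) auto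
  finally show ?thesis .
qed

lemma finite_measure_unit_square: "finite_measure (lebesgue_on unit_square)"
  by (rule finite_measureI) (simp only: emeasure_unit_square, simp)

text \<open>The constant for block \<open>l\<close> is \<open>2\<^sup>l\<close> times the bound of \<open>abs_block_diff_le\<close> for the distance between
block and step function.\<close>

definition mu :: "nat \<Rightarrow> real \<times> real \<Rightarrow> real" where
  "mu l0 = weight (\<lambda>l. 2 ^ l * (2 * \<bar>height l\<bar> * (real a ^ (3 * stage l))\<^sup>2)) piece_bad l0"

definition weighted_measure :: "nat \<Rightarrow> (real \<times> real) measure" where
  "weighted_measure l0 = density (lebesgue_on unit_square) (\<lambda>z. ennreal (mu l0 z))"

lemma borel_measurable_unit_square:
  "h \<in> borel_measurable borel \<Longrightarrow> h \<in> borel_measurable (lebesgue_on unit_square)"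
  by (intro measurable_restrict_space1 measurable_completion) simp

lemma piece_bad_sets: "piece_bad l \<in> sets (lebesgue_on unit_square)"
proof -
  have "piece_bad l \<in> sets lebesgue" using bad_set_sets by simp
  moreover have "piece_bad l = unit_square \<inter> piece_bad l" by (auto simp: bad_set_def)
  ultimately show ?thesis by (auto simp: sets_restrict_space)
qed

lemma mu_measurable: "mu l0 \<in> borel_measurable (lebesgue_on unit_square)"
  unfolding mu_def by (rule weight_measurable[OF piece_bad_sets])

lemma mu_bounds: "0 < mu l0 z" "mu l0 z \<le> 1"
  unfolding mu_def by (simp_all only: weight_pos_le_1)

lemma sets_weighted_measure: "sets (weighted_measure l0) = sets (lebesgue_on unit_square)"
  by (simp add: weighted_measure_def)

lemma measurable_weighted_measure:
  "h \<in> borel_measurable borel \<Longrightarrow> h \<in> borel_measurable (weighted_measure l0)"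
  using borel_measurable_unit_square measurable_cong_sets[OF sets_weighted_measure refl] by blast

lemma nn_integral_weighted_measure:
  assumes "h \<in> borel_measurable (lebesgue_on unit_square)"
  shows "(\<integral>\<^sup>+z. h z \<partial>weighted_measure l0) = (\<integral>\<^sup>+z. ennreal (mu l0 z) * h z \<partial>lebesgue_on unit_square)"
  unfolding weighted_measure_def using assms mu_measurable by (intro nn_integral_density) auto

lemma nn_integral_weighted_measure_le:
  assumes "h \<in> borel_measurable (lebesgue_on unit_square)"
  shows "(\<integral>\<^sup>+z. h z \<partial>weighted_measure l0) \<le> (\<integral>\<^sup>+z. h z \<partial>lebesgue_on unit_square)"
  unfolding nn_integral_weighted_measure[OF assms]
proof (rule nn_integral_mono)
  fix z
  have "ennreal (mu l0 z) * h z \<le> 1 * h z"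
    using mu_bounds by (intro mult_right_mono) (auto simp: ennreal_le_1)
  then show "ennreal (mu l0 z) * h z \<le> h z" by simp
qed

lemma weighted_measure_space_le: "emeasure (weighted_measure l0) (space (weighted_measure l0)) \<le> 1"
proof -
  have "emeasure (weighted_measure l0) (space (weighted_measure l0)) = (\<integral>\<^sup>+z. 1 \<partial>weighted_measure l0)"
    by (simp only: nn_integral_const mult_1)
  also have "\<dots> \<le> (\<integral>\<^sup>+z. 1 \<partial>lebesgue_on unit_square)"
    by (rule nn_integral_weighted_measure_le) simp
  also have "\<dots> = 1" by (simp only: nn_integral_const mult_1 emeasure_unit_square)
  finally show ?thesis .
qed

lemma finite_weighted_measure: "finite_measure (weighted_measure l0)"
  using weighted_measure_space_le[of l0] by (intro finite_measureI) (auto simp: top_unique)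

lemma abs_continuous_weighted_measure:
  "absolutely_continuous (lebesgue_on unit_square) (weighted_measure l0)"
  unfolding weighted_measure_def using mu_measurable by (intro absolutely_continuousI_density) auto

lemma AE_weighted_measure_less_1:
  "AE z in weighted_measure l0. z \<in> {0..<1} \<times> {0..<1}"
proof -
  have "AE z in lebesgue. fst z \<noteq> (1::real) \<and> snd z \<noteq> (1::real)"
    using AE_completion[OF AE_lborel_less_1] .
  then have "AE z in lebesgue. z \<in> unit_square \<longrightarrow> z \<in> {0..<1} \<times> {0..<1::real}"
    by (rule eventually_mono) (auto simp: less_le)
  moreover have "unit_square \<inter> space lebesgue \<in> sets (lebesgue :: (real \<times> real) measure)"
    using unit_square_sets by simp
  ultimately have "AE z in lebesgue_on unit_square. z \<in> {0..<1} \<times> {0..<1}"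
    using AE_restrict_space_iff by blast
  then show ?thesis
    by (rule absolutely_continuous_AE[OF sets_weighted_measure abs_continuous_weighted_measure])
qed

lemma integrable_weighted_measure:
  fixes h :: "real \<times> real \<Rightarrow> real"
  assumes "h \<in> borel_measurable borel" "\<And>z. \<bar>h z\<bar> \<le> b"
  shows "integrable (weighted_measure l0) h"
proof -
  interpret finite_measure "weighted_measure l0" by (rule finite_weighted_measure)
  show ?thesis
    by (rule integrable_const_bound[where B = b]) (use assms measurable_weighted_measure in auto)
qed

lemma abs_square_step_le: "\<bar>square_step \<gamma> r i j z\<bar> \<le> \<bar>\<gamma>\<bar>"
  by (auto simp: square_step_def of_bool_def split: prod.splits)

lemma integrable_piece_step: "integrable (weighted_measure l0) (piece_step l)"
  by (rule integrable_weighted_measure[OF borel_measurable_square_step abs_square_step_le])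

lemma integrable_piece_poly: "integrable (weighted_measure l0) (piece_poly l)"
proof (rule integrable_weighted_measure[OF borel_measurable_block])
  fix z
  show "\<bar>piece_poly l z\<bar> \<le> \<bar>height l\<bar> + 2 * \<bar>height l\<bar> * (real a ^ (3 * stage l))\<^sup>2"
    using abs_block_diff_le[of "height l" "stage l * stage l" "row l" "col l" "offset l" "3 * stage l" z]
      abs_square_step_le[of "height l" "stage l * stage l" "row l" "col l" z] by linarith
qed

text \<open>The integrand vanishes off the bad set, and there the weight compensates both the size of the block and the
factor \<open>2\<^sup>l\<close>.\<close>

lemma integral_piece_error_le:
  assumes "l \<ge> l0"
  shows "(\<integral>z. \<bar>piece_poly l z - piece_step l z\<bar> \<partial>weighted_measure l0) \<le> (1/2) ^ l"
proof -
  interpret finite_measure "lebesgue_on unit_square" by (rule finite_measure_unit_square)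
  let ?d = "\<lambda>z. \<bar>piece_poly l z - piece_step l z\<bar>"
  let ?D = "2 * \<bar>height l\<bar> * (real a ^ (3 * stage l))\<^sup>2"
  have d: "?d \<in> borel_measurable (lebesgue_on unit_square)"
    by (rule borel_measurable_unit_square) measurable
  have nn: "AE z in lebesgue_on unit_square. 0 \<le> mu l0 z"
    using mu_bounds(1) by (intro AE_I2 less_imp_le)
  have "AE z in lebesgue_on unit_square. \<forall>i\<ge>l0. z \<in> piece_bad i \<longrightarrow> mu l0 z \<le> 1 / (1 + 2 ^ i * (2 * \<bar>height i\<bar> * (real a ^ (3 * stage i))\<^sup>2))"
    unfolding mu_def by (rule weight_le) (auto simp: piece_bad_sets emeasure_eq_measure summable_bad_sets)
  then have le: "AE z in lebesgue_on unit_square. mu l0 z *\<^sub>R ?d z \<le> (1/2) ^ l"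
    using AE_space
  proof eventually_elim
    case (elim z)
    show ?case
    proof (cases "z \<in> piece_bad l")
      case False
      then have "?d z = 0" using elim by (simp add: block_eq_square_step)
      then show ?thesis by simp
    next
      case True
      then have "mu l0 z * ?d z \<le> 1 / (1 + 2 ^ l * ?D) * ?D"
        using elim assms mu_bounds(1)[of l0 z] abs_block_diff_le by (intro mult_mono) auto
      also have "\<dots> \<le> (1/2) ^ l"
        by (simp add: divide_le_eq add_pos_nonneg power_one_over) (simp add: field_simps)
      finally show ?thesis by simp
    qed
  qed
  have "(\<integral>z. ?d z \<partial>weighted_measure l0) = (\<integral>z. mu l0 z *\<^sub>R ?d z \<partial>lebesgue_on unit_square)"
    unfolding weighted_measure_def by (rule integral_density[OF d mu_measurable nn])
  also have "\<dots> \<le> (\<integral>z. (1/2) ^ l \<partial>lebesgue_on unit_square)"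
  proof (rule integral_mono_AE[OF _ _ le])
    have "integrable (weighted_measure l0) ?d"
      using integrable_piece_poly integrable_piece_step by auto
    then show "integrable (lebesgue_on unit_square) (\<lambda>z. mu l0 z *\<^sub>R ?d z)"
      unfolding weighted_measure_def by (simp only: integrable_density[OF d mu_measurable nn])
  qed simp
  also have "\<dots> = (1/2) ^ l"
    using emeasure_unit_square by (simp only: lebesgue_integral_const measure_def) simp
  finally show ?thesis .
qed

lemma stage_height_near:
  assumes "\<bar>G\<bar> \<le> real a ^ s"
  defines "k \<equiv> nat \<lfloor>(G + real a ^ s) * real a ^ s\<rfloor>"
  shows "k \<le> 2 * a ^ (2 * s)" "\<bar>stage_height s k - G\<bar> \<le> (1 / real a) ^ s"
proof -
  have A: "real a ^ s > 0" using base_ge_2 by simp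
  define t where "t = (G + real a ^ s) * real a ^ s"
  have sq: "real a ^ (2 * s) = real a ^ s * real a ^ s" by (simp only: mult_2 power_add)
  have t: "0 \<le> t" "t \<le> 2 * real a ^ (2 * s)"
  proof -
    show "0 \<le> t" using assms(1) A unfolding t_def by (intro mult_nonneg_nonneg) auto
    have "t \<le> (2 * real a ^ s) * real a ^ s" using assms(1) A unfolding t_def by (intro mult_right_mono) auto
    then show "t \<le> 2 * real a ^ (2 * s)" by (simp add: sq)
  qed
  have k: "real k \<le> t" "t < real k + 1"
    using t(1) unfolding k_def t_def[symmetric] by linarith+
  then have "real k \<le> real (2 * a ^ (2 * s))" using t(2) by simp
  then show "k \<le> 2 * a ^ (2 * s)" by (simp only: of_nat_le_iff)
  have "stage_height s k - G = (real k - t) / real a ^ s"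
    unfolding stage_height_def t_def sq using A by (simp add: field_simps)
  moreover have "\<bar>(real k - t) / real a ^ s\<bar> \<le> 1 / real a ^ s"
    using k A by (simp add: abs_divide divide_right_mono)
  ultimately show "\<bar>stage_height s k - G\<bar> \<le> (1 / real a) ^ s" by (simp add: power_one_over)
qed

lemma grid_cell_near:
  assumes "0 \<le> x" "x < 1"
  shows "grid m (cell m x) \<in> {0..1}" "\<bar>x - grid m (cell m x)\<bar> \<le> 1 / real a ^ m"
proof -
  have "grid m (cell m x) \<le> x \<and> x < grid m (Suc (cell m x))"
    using cell_eq_iff[OF assms, of m "cell m x"] by simp
  moreover have "grid m (Suc i) = grid m i + 1 / real a ^ m" for i
    by (simp add: grid_def add_divide_distrib)
  moreover have "grid m i \<ge> 0" for i by (simp add: grid_def)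
  ultimately show "grid m (cell m x) \<in> {0..1}" "\<bar>x - grid m (cell m x)\<bar> \<le> 1 / real a ^ m"
    using assms by auto
qed

text \<open>Taking one piece of stage \<open>s\<close> over each square produces an arbitrary step function with the available heights.
As the supports are disjoint, a partial sum at a point is either 0 or the full value.\<close>

lemma step_selection:
  assumes k: "\<And>c d. k c d \<le> 2 * a ^ (2 * s)"
  shows "\<exists>F. finite F \<and> (\<forall>l\<in>F. stage l = s) \<and>
    (\<forall>x y. (\<Sum>l\<in>F. piece_step l (x, y)) = stage_height s (k (cell (s * s) x) (cell (s * s) y))) \<and>
    (\<forall>G z. \<bar>\<Sum>l\<in>F \<inter> G. piece_step l z\<bar> \<le> \<bar>\<Sum>l\<in>F. piece_step l z\<bar>)"
proof -
  define idx where "idx c d = inv_into UNIV piece (s, k c d, c, d)" for c d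
  define F where "F = (\<lambda>(c, d). idx c d) ` ({..<a ^ (s * s)} \<times> {..<a ^ (s * s)})"
  have idx: "piece (idx c d) = (s, k c d, c, d)" if "c < a ^ (s * s)" "d < a ^ (s * s)" for c d
  proof -
    have "(s, k c d, c, d) \<in> range piece"
      using that k bij_piece by (auto simp: bij_betw_def pieces_def)
    then show ?thesis unfolding idx_def by (rule f_inv_into_f)
  qed
  have sum: "(\<Sum>l\<in>F \<inter> G. piece_step l (x, y)) =
      (if idx (cell (s * s) x) (cell (s * s) y) \<in> G then stage_height s (k (cell (s * s) x) (cell (s * s) y)) else 0)"
    for G x y
  proof -
    let ?l = "idx (cell (s * s) x) (cell (s * s) y)"
    let ?v = "stage_height s (k (cell (s * s) x) (cell (s * s) y))"
    have "piece_step l (x, y) = (if l = ?l then ?v else 0)" if "l \<in> F" for l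
    proof -
      obtain c d where cd: "c < a ^ (s * s)" "d < a ^ (s * s)" "l = idx c d"
        using \<open>l \<in> F\<close> unfolding F_def by auto
      have p: "piece l = (s, k c d, c, d)" using idx cd by simp
      have p': "piece ?l = (s, k (cell (s * s) x) (cell (s * s) y), cell (s * s) x, cell (s * s) y)"
        using idx cell_less by simp
      have "l = ?l \<longleftrightarrow> c = cell (s * s) x \<and> d = cell (s * s) y"
      proof
        assume "l = ?l"
        then have "(s, k c d, c, d) = (s, k (cell (s * s) x) (cell (s * s) y), cell (s * s) x, cell (s * s) y)"
          using p p' by (simp only:)
        then show "c = cell (s * s) x \<and> d = cell (s * s) y" by (simp only: prod.inject)
      qed (simp only: cd(3))
      moreover have "piece_step l (x, y) = stage_height s (k c d) * of_bool (cell (s * s) x = c) * of_bool (cell (s * s) y = d)"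
        by (simp add: square_step_def height_def stage_def row_def col_def p)
      ultimately show ?thesis by auto
    qed
    then have "(\<Sum>l\<in>F \<inter> G. piece_step l (x, y)) = (\<Sum>l\<in>F \<inter> G. if l = ?l then ?v else 0)"
      by (intro sum.cong) auto
    also have "\<dots> = (if ?l \<in> F \<inter> G then ?v else 0)"
      by (rule sum.delta) (simp add: F_def)
    also have "?l \<in> F \<inter> G \<longleftrightarrow> ?l \<in> G" using cell_less by (auto simp: F_def)
    finally show ?thesis .
  qed
  have full: "(\<Sum>l\<in>F. piece_step l (x, y)) = stage_height s (k (cell (s * s) x) (cell (s * s) y))" for x y
    using sum[where G = UNIV and x = x and y = y] by simp
  have "\<bar>\<Sum>l\<in>F \<inter> G. piece_step l z\<bar> \<le> \<bar>\<Sum>l\<in>F. piece_step l z\<bar>" for G z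
    using sum[where G = G and x = "fst z" and y = "snd z"] full[where x = "fst z" and y = "snd z"] by auto
  moreover have "\<forall>l\<in>F. stage l = s"
    using idx by (auto simp: F_def stage_def)
  moreover have "finite F" by (simp add: F_def)
  ultimately show ?thesis using full by (intro exI[of _ F] conjI allI)
qed

lemma continuous_step_approximation:
  fixes g :: "real \<times> real \<Rightarrow> real"
  assumes g: "continuous_on UNIV g" and "\<eta> > 0"
  shows "\<exists>F. finite F \<and> F \<subseteq> {N..} \<and>
    (\<forall>z\<in>{0..<1} \<times> {0..<1}. \<bar>g z - (\<Sum>l\<in>F. piece_step l z)\<bar> \<le> \<eta>) \<and>
    (\<forall>G z. \<bar>\<Sum>l\<in>F \<inter> G. piece_step l z\<bar> \<le> \<bar>\<Sum>l\<in>F. piece_step l z\<bar>)"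
proof -
  have compact: "compact unit_square" by (intro compact_Times compact_Icc)
  have gS: "continuous_on unit_square g" using g continuous_on_subset by blast
  have "uniformly_continuous_on unit_square g"
    using compact_uniformly_continuous[OF gS compact] .
  then obtain d where d: "d > 0" "\<And>z z'. z \<in> unit_square \<Longrightarrow> z' \<in> unit_square \<Longrightarrow> dist z' z < d \<Longrightarrow> dist (g z') (g z) < \<eta> / 2"
    unfolding uniformly_continuous_on_def using \<open>\<eta> > 0\<close> by (meson half_gt_zero)
  have "bounded (g ` unit_square)" using compact_continuous_image[OF gS compact] compact_imp_bounded by blast
  then obtain b where b: "b > 0" "\<And>z. z \<in> unit_square \<Longrightarrow> \<bar>g z\<bar> \<le> b"
    unfolding bounded_pos by auto
  define e where "e = min (\<eta> / 2) (min (d / 2) (1 / b))"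
  have "e > 0" using \<open>\<eta> > 0\<close> d b by (simp add: e_def)
  have "(\<lambda>s. (1 / real a) ^ s) \<longlonglongrightarrow> 0" using base_ge_2 by (intro LIMSEQ_power_zero) simp
  then have "\<forall>\<^sub>F s in sequentially. (1 / real a) ^ s < e" using \<open>e > 0\<close> by (rule order_tendstoD)
  moreover have "\<forall>\<^sub>F s in sequentially. s > Max (insert 0 (stage ` {..<N}))" by (rule eventually_gt_at_top)
  ultimately have "\<forall>\<^sub>F s in sequentially. (1 / real a) ^ s < e \<and> s > Max (insert 0 (stage ` {..<N}))" by eventually_elim simp
  then obtain s where s: "(1 / real a) ^ s < e" "s > Max (insert 0 (stage ` {..<N}))"
    by (auto simp: eventually_sequentially)
  have A: "real a ^ s > 0" using base_ge_2 by simp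
  have "1 / real a ^ s < 1 / b" using s(1) by (simp add: e_def power_one_over)
  then have bs: "b \<le> real a ^ s" using A b(1) by (simp add: field_simps)
  \<comment> \<open>The value of \<open>g\<close> at the corner of a cell is rounded to an available height. The minimum
    keeps the corner in the square for indices that belong to no cell, too.\<close>
  let ?p = "\<lambda>c d. (min 1 (grid (s * s) c), min 1 (grid (s * s) d))"
  define k where "k c d = nat \<lfloor>(g (?p c d) + real a ^ s) * real a ^ s\<rfloor>" for c d
  have p: "?p c d \<in> unit_square" for c d by (simp add: grid_def)
  have gp: "\<bar>g (?p c d)\<bar> \<le> real a ^ s" for c d using b(2)[OF p] bs by (rule order.trans)
  have k2: "k c d \<le> 2 * a ^ (2 * s)" for c d
    unfolding k_def by (rule stage_height_near(1)[OF gp])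
  obtain F where F: "finite F" "\<forall>l\<in>F. stage l = s"
    "\<forall>x y. (\<Sum>l\<in>F. piece_step l (x, y)) = stage_height s (k (cell (s * s) x) (cell (s * s) y))"
    "\<forall>G z. \<bar>\<Sum>l\<in>F \<inter> G. piece_step l z\<bar> \<le> \<bar>\<Sum>l\<in>F. piece_step l z\<bar>"
    using step_selection[of k s, OF k2] by (elim exE conjE)
  have FN: "F \<subseteq> {N..}"
  proof
    fix l assume "l \<in> F"
    have "\<not> l < N"
    proof
      assume "l < N"
      then have "stage l \<le> Max (insert 0 (stage ` {..<N}))" by (intro Max_ge) auto
      then show False using s(2) F(2) \<open>l \<in> F\<close> by simp
    qed
    then show "l \<in> {N..}" by simp
  qed
  have near: "\<bar>g z - (\<Sum>l\<in>F. piece_step l z)\<bar> \<le> \<eta>" if "z \<in> {0..<1} \<times> {0..<1}" for z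
  proof -
    obtain x y where z: "z = (x, y)" and x: "0 \<le> x" "x < 1" and y: "0 \<le> y" "y < 1" using \<open>z \<in> {0..<1} \<times> {0..<1}\<close> by auto
    let ?c = "cell (s * s) x" and ?d = "cell (s * s) y"
    have pc: "?p ?c ?d = (grid (s * s) ?c, grid (s * s) ?d)"
      using grid_cell_near(1)[OF x] grid_cell_near(1)[OF y] by simp
    have "dist (x, y) (?p ?c ?d) \<le> \<bar>x - grid (s * s) ?c\<bar> + \<bar>y - grid (s * s) ?d\<bar>"
      unfolding pc dist_Pair_Pair by (rule order.trans[OF sqrt_sum_squares_le_sum_abs]) (simp add: dist_real_def)
    also have "\<dots> \<le> 1 / real a ^ (s * s) + 1 / real a ^ (s * s)"
      using grid_cell_near(2)[OF x] grid_cell_near(2)[OF y] by (intro add_mono)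
    also have "\<dots> = 2 * (1 / real a) ^ (s * s)" by (simp add: power_one_over)
    also have "\<dots> \<le> 2 * (1 / real a) ^ s"
      using base_ge_2 by (intro mult_left_mono power_decreasing) auto
    also have "\<dots> < d" using s(1) by (simp add: e_def)
    finally have "dist (g (x, y)) (g (?p ?c ?d)) < \<eta> / 2"
      using d(2)[OF p, of "(x, y)"] x y by simp
    moreover have "\<bar>stage_height s (k ?c ?d) - g (?p ?c ?d)\<bar> \<le> \<eta> / 2"
      using stage_height_near(2)[OF gp, of ?c ?d] s(1) unfolding k_def by (simp add: e_def)
    moreover have "(\<Sum>l\<in>F. piece_step l (x, y)) = stage_height s (k ?c ?d)"
      using F(3) by blast
    ultimately show ?thesis unfolding z dist_real_def by linarith
  qed
  with F(1,4) FN show ?thesis by (intro exI[of _ F] conjI ballI)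
qed

text \<open>The hypothesis of \<open>greedy_selection\<close> for the blocks. The error has three parts: from \<open>f\<close> to a continuous function,
from there to a step function, from the steps to the blocks.\<close>

lemma weighted_approximation:
  assumes f: "integrable (weighted_measure l0) f" and "\<eta> > 0"
  shows "\<exists>F. finite F \<and> F \<subseteq> {N..} \<and>
      (\<integral>z. \<bar>f z - (\<Sum>i\<in>F. piece_poly i z)\<bar> \<partial>weighted_measure l0) \<le> \<eta> \<and>
      (\<forall>m. (\<integral>z. \<bar>\<Sum>i\<in>F \<inter> {..<m}. piece_poly i z\<bar> \<partial>weighted_measure l0)
         \<le> (\<integral>z. \<bar>f z\<bar> \<partial>weighted_measure l0) + \<eta>)"
proof -
  let ?M = "weighted_measure l0"
  interpret finite_measure ?M by (rule finite_weighted_measure)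
  have space1: "measure ?M (space ?M) \<le> 1"
    using weighted_measure_space_le[of l0] by (simp add: emeasure_eq_measure)
  define E where "E g = (\<integral>z. \<bar>g z\<bar> \<partial>?M)" for g :: "real \<times> real \<Rightarrow> real"
  have tri: "E (\<lambda>z. g z + h z) \<le> E g + E h" if "integrable ?M g" "integrable ?M h" for g h
  proof -
    have "E (\<lambda>z. g z + h z) \<le> (\<integral>z. \<bar>g z\<bar> + \<bar>h z\<bar> \<partial>?M)"
      unfolding E_def using that by (intro integral_mono) auto
    also have "\<dots> = E g + E h" unfolding E_def using that by simp
    finally show ?thesis .
  qed
  have sets: "unit_square \<in> sets (lebesgue :: (real \<times> real) measure)" by (rule unit_square_sets)
  obtain g where g: "continuous_on UNIV g" "integrable ?M g" and fg: "E (\<lambda>z. f z - g z) < \<eta> / 4"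
    using continuous_dense_L1[OF sets sets_weighted_measure finite_weighted_measure abs_continuous_weighted_measure f, of "\<eta> / 4"]
      \<open>\<eta> > 0\<close> unfolding E_def by auto
  obtain N1 where N1: "(1/2::real) ^ N1 < \<eta> / 8"
    using real_arch_pow_inv[of "\<eta> / 8" "1/2"] \<open>\<eta> > 0\<close> by auto
  define N' where "N' = max N1 (max N l0)"
  have N': "2 * (1/2::real) ^ N' \<le> \<eta> / 4"
  proof -
    have "(1/2::real) ^ N' \<le> (1/2) ^ N1" by (intro power_decreasing) (auto simp: N'_def)
    with N1 show ?thesis by linarith
  qed
  have pos: "\<eta> / 4 > 0" using \<open>\<eta> > 0\<close> by simp
  obtain F where F: "finite F" "F \<subseteq> {N'..}"
    and near: "\<forall>z\<in>{0..<1} \<times> {0..<1}. \<bar>g z - (\<Sum>l\<in>F. piece_step l z)\<bar> \<le> \<eta> / 4"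
    and part: "\<forall>G z. \<bar>\<Sum>l\<in>F \<inter> G. piece_step l z\<bar> \<le> \<bar>\<Sum>l\<in>F. piece_step l z\<bar>"
    using continuous_step_approximation[OF g(1) pos, of N'] by (elim exE conjE)
  let ?P = "\<lambda>G z. \<Sum>i\<in>G. piece_poly i z" and ?S = "\<lambda>G z. \<Sum>i\<in>G. piece_step i z"
  have intP: "integrable ?M (?P G)" and intS: "integrable ?M (?S G)" for G
    using integrable_piece_poly integrable_piece_step by auto
  have gS: "E (\<lambda>z. g z - ?S F z) \<le> \<eta> / 4"
  proof -
    have "E (\<lambda>z. g z - ?S F z) \<le> (\<integral>z. \<eta> / 4 \<partial>?M)"
      unfolding E_def
    proof (rule integral_mono_AE)
      show "AE z in ?M. \<bar>g z - ?S F z\<bar> \<le> \<eta> / 4"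
        using AE_weighted_measure_less_1 by eventually_elim (rule bspec[OF near])
    qed (use g intS in auto)
    also have "\<dots> \<le> \<eta> / 4"
      using space1 \<open>\<eta> > 0\<close> by (simp add: mult_left_le_one_le)
    finally show ?thesis .
  qed
  have err: "E (\<lambda>z. ?P G z - ?S G z) \<le> \<eta> / 4" if "G \<subseteq> F" for G
  proof -
    have fin: "finite G" using that F finite_subset by blast
    have "E (\<lambda>z. ?P G z - ?S G z) \<le> (\<integral>z. (\<Sum>i\<in>G. \<bar>piece_poly i z - piece_step i z\<bar>) \<partial>?M)"
      unfolding E_def sum_subtractf[symmetric]
      using integrable_piece_poly integrable_piece_step by (intro integral_mono) auto
    also have "\<dots> = (\<Sum>i\<in>G. \<integral>z. \<bar>piece_poly i z - piece_step i z\<bar> \<partial>?M)"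
      using integrable_piece_poly integrable_piece_step by (intro Bochner_Integration.integral_sum) auto
    also have "\<dots> \<le> (\<Sum>i\<in>G. (1/2) ^ i)"
      using that F by (intro sum_mono integral_piece_error_le) (auto simp: N'_def)
    also have "\<dots> \<le> 2 * (1/2) ^ N'" using that F fin by (intro sum_half_powers_le) auto
    finally show ?thesis using N' by simp
  qed
  have "E (\<lambda>z. f z - ?P F z) = E (\<lambda>z. (f z - g z) + ((g z - ?S F z) + - (?P F z - ?S F z)))"
    unfolding E_def by (intro Bochner_Integration.integral_cong refl arg_cong[of _ _ abs]) simp
  also have "\<dots> \<le> E (\<lambda>z. f z - g z) + E (\<lambda>z. (g z - ?S F z) + - (?P F z - ?S F z))"
    using f g intP intS by (intro tri) auto
  also have "E (\<lambda>z. (g z - ?S F z) + - (?P F z - ?S F z)) \<le> E (\<lambda>z. g z - ?S F z) + E (\<lambda>z. - (?P F z - ?S F z))"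
    using f g intP intS by (intro tri) auto
  also have "E (\<lambda>z. - (?P F z - ?S F z)) = E (\<lambda>z. ?P F z - ?S F z)"
    unfolding E_def by (simp only: abs_minus_cancel)
  finally have main: "E (\<lambda>z. f z - ?P F z) \<le> \<eta>"
    using fg gS err[of F] \<open>\<eta> > 0\<close> by simp
  have "E (?P (F \<inter> {..<m})) \<le> E f + \<eta>" for m
  proof -
    let ?G = "F \<inter> {..<m}"
    have "E (?P ?G) = E (\<lambda>z. (?P ?G z - ?S ?G z) + ?S ?G z)" by simp
    also have "\<dots> \<le> E (\<lambda>z. ?P ?G z - ?S ?G z) + E (?S ?G)"
      using intP intS by (intro tri) auto
    also have "E (?S ?G) \<le> E (?S F)"
      unfolding E_def using intS part by (intro integral_mono) auto
    also have "E (?S F) = E (\<lambda>z. f z + (- (f z - g z) + - (g z - ?S F z)))"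
      by simp
    also have "\<dots> \<le> E f + E (\<lambda>z. - (f z - g z) + - (g z - ?S F z))"
      using f g intS by (intro tri) auto
    also have "E (\<lambda>z. - (f z - g z) + - (g z - ?S F z)) \<le> E (\<lambda>z. - (f z - g z)) + E (\<lambda>z. - (g z - ?S F z))"
      using f g intS by (intro tri) auto
    also have "\<dots> = E (\<lambda>z. f z - g z) + E (\<lambda>z. g z - ?S F z)"
      unfolding E_def by (simp only: abs_minus_cancel)
    finally show ?thesis using fg gS err[of ?G] \<open>\<eta> > 0\<close> by simp
  qed
  with main F show ?thesis unfolding E_def N'_def by (intro exI[of _ F]) auto
qed

section \<open>Spherical and rectangular partial sums\<close>

lemma sph_sum_eq_walsh_poly: "sph_sum a d R = walsh_poly (\<lambda>(k, \<nu>). d k \<nu>) (sph_index R)"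
  by (auto simp: sph_sum_def walsh_poly_def split_beta intro!: ext sum.cong)

lemma rect_sum_eq_walsh_poly: "rect_sum a d = (\<lambda>(n, m). walsh_poly (\<lambda>(k, \<nu>). d k \<nu>) ({1..n} \<times> {1..m}))"
  by (auto simp: rect_sum_def walsh_poly_def sum.cartesian_product split_beta intro!: ext sum.cong)

lemma spectrum_bounds:
  assumes "(k, \<nu>) \<in> spectrum h" "(k', \<nu>') \<in> spectrum l" "h < l"
  shows "k < k'" "\<nu> < \<nu>'"
proof -
  have "a ^ (offset h + 3 * stage h) \<le> a ^ offset l"
    using base_ge_2 offset_separated[OF assms(3)] by (intro power_increasing) auto
  then show "k < k'" "\<nu> < \<nu>'" using assms(1,2) by (auto simp: frequencies_def)
qed

lemma spectrum_ge_1: "spectrum l \<subseteq> {1..} \<times> {1..}"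
proof -
  have "1 \<le> a ^ offset l" using base_ge_2 by simp
  then show ?thesis by (auto simp: frequencies_def)
qed

text \<open>A frequency set that exhausts the blocks in order, up to a cut inside block \<open>m\<close>.\<close>

lemma walsh_poly_subseries:
  assumes G: "finite G" and low: "\<And>l. l < m \<Longrightarrow> spectrum l \<subseteq> G" and high: "\<And>l. l > m \<Longrightarrow> spectrum l \<inter> G = {}"
  shows "walsh_poly (\<lambda>(k, \<nu>). subseries (\<Union>l\<in>I. spectrum l) series_coeff k \<nu>) G z =
    complex_of_real (\<Sum>l\<in>I \<inter> {..<m}. piece_poly l z) +
    walsh_poly (piece_coeff m) (spectrum m \<inter> (if m \<in> I then G else {})) z"
proof -
  obtain x y where z: "z = (x, y)" by force
  let ?W = "\<lambda>p. walsh a (fst p) x * walsh a (snd p) y"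
  let ?d = "\<lambda>(k, \<nu>). subseries (\<Union>l\<in>I. spectrum l) series_coeff k \<nu>"
  have wp: "walsh_poly C G z = (\<Sum>p\<in>G. C p * ?W p)" for C G
    by (simp add: walsh_poly_def z split_beta mult.assoc)
  let ?J = "I \<inter> {..m}"
  have "walsh_poly ?d G z = (\<Sum>p\<in>(\<Union>l\<in>?J. spectrum l \<inter> G). ?d p * ?W p)"
    unfolding wp
  proof (rule sum.mono_neutral_right[OF G])
    show "\<forall>p\<in>G - (\<Union>l\<in>?J. spectrum l \<inter> G). ?d p * ?W p = 0"
      using high by (force simp: subseries_def not_le[symmetric])
  qed auto
  also have "\<dots> = (\<Sum>l\<in>?J. \<Sum>p\<in>spectrum l \<inter> G. ?d p * ?W p)"
  proof (rule sum.UNION_disjoint)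
    show "\<forall>h\<in>?J. \<forall>l\<in>?J. h \<noteq> l \<longrightarrow> spectrum h \<inter> G \<inter> (spectrum l \<inter> G) = {}"
      using spectrum_disjoint by (intro ballI impI) blast
  qed (auto simp: finite_spectrum)
  also have "\<dots> = (\<Sum>l\<in>?J. walsh_poly (piece_coeff l) (spectrum l \<inter> G) z)"
    unfolding wp
  proof (intro sum.cong refl)
    fix l p assume "l \<in> ?J" "p \<in> spectrum l \<inter> G"
    moreover obtain k \<nu> where "p = (k, \<nu>)" by force
    ultimately have "?d p = piece_coeff l p"
      using series_coeff_spectrum[of k \<nu> l] by (auto simp: subseries_def)
    then show "?d p * ?W p = piece_coeff l p * ?W p" by (rule arg_cong)
  qed
  also have "?J = (I \<inter> {..<m}) \<union> (I \<inter> {m})" by auto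
  also have "(\<Sum>l\<in>(I \<inter> {..<m}) \<union> (I \<inter> {m}). walsh_poly (piece_coeff l) (spectrum l \<inter> G) z) =
    (\<Sum>l\<in>I \<inter> {..<m}. walsh_poly (piece_coeff l) (spectrum l \<inter> G) z) + (\<Sum>l\<in>I \<inter> {m}. walsh_poly (piece_coeff l) (spectrum l \<inter> G) z)"
    by (rule sum.union_disjoint) auto
  also have "(\<Sum>l\<in>I \<inter> {..<m}. walsh_poly (piece_coeff l) (spectrum l \<inter> G) z) = (\<Sum>l\<in>I \<inter> {..<m}. complex_of_real (piece_poly l z))"
  proof (rule sum.cong[OF refl])
    fix l assume "l \<in> I \<inter> {..<m}"
    then have "spectrum l \<inter> G = spectrum l" using low[of l] by blast
    then show "walsh_poly (piece_coeff l) (spectrum l \<inter> G) z = complex_of_real (piece_poly l z)"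
      using block_expansion[OF stage_le_offset row_less col_less] by simp
  qed
  also have "(\<Sum>l\<in>I \<inter> {m}. walsh_poly (piece_coeff l) (spectrum l \<inter> G) z) =
     walsh_poly (piece_coeff m) (spectrum m \<inter> (if m \<in> I then G else {})) z"
    by (simp add: wp)
  finally show ?thesis by simp
qed

lemma nn_integral_subseries_error:
  fixes f :: "real \<times> real \<Rightarrow> real"
  assumes f: "integrable (weighted_measure l0) f"
    and G: "finite G" "\<And>l. l < m \<Longrightarrow> spectrum l \<subseteq> G" "\<And>l. l > m \<Longrightarrow> spectrum l \<inter> G = {}"
  shows "(\<integral>\<^sup>+z. ennreal (norm (walsh_poly (\<lambda>(k, \<nu>). subseries (\<Union>l\<in>I. spectrum l) series_coeff k \<nu>) G z
      - complex_of_real (f z)) * mu l0 z) \<partial>lebesgue_on unit_square)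
    \<le> ennreal ((\<integral>z. \<bar>f z - (\<Sum>l\<in>I \<inter> {..<m}. piece_poly l z)\<bar> \<partial>weighted_measure l0) + partial_bound m)"
proof -
  let ?L = "lebesgue_on unit_square"
  let ?R = "\<lambda>z. \<bar>f z - (\<Sum>l\<in>I \<inter> {..<m}. piece_poly l z)\<bar>"
  let ?G = "if m \<in> I then G else {}"
  let ?w = "\<lambda>z. walsh_poly (piece_coeff m) (spectrum m \<inter> ?G) z"
  have fL: "f \<in> borel_measurable ?L"
    using borel_measurable_integrable[OF f] measurable_cong_sets[OF sets_weighted_measure refl] by blast
  have intR: "integrable (weighted_measure l0) ?R"
    using f integrable_piece_poly by auto
  have RL: "?R \<in> borel_measurable ?L"
    using borel_measurable_integrable[OF intR] measurable_cong_sets[OF sets_weighted_measure refl] by blast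
  have wm: "walsh_poly C S \<in> borel_measurable borel" for C S
  proof -
    have "(\<lambda>p. case p of (x, y) \<Rightarrow> C (k, \<nu>) * walsh a k x * walsh a \<nu> y) \<in> borel_measurable (borel \<Otimes>\<^sub>M borel)" for k \<nu>
      by measurable
    then show ?thesis
      unfolding walsh_poly_def borel_prod[symmetric] split_beta by (intro borel_measurable_sum) (auto simp: split_beta)
  qed
  have "(\<lambda>z. norm (?w z)) \<in> borel_measurable borel"
    by (rule measurable_compose[OF wm borel_measurable_norm])
  from borel_measurable_unit_square[OF this]
  have wL: "(\<lambda>z. ennreal (norm (?w z))) \<in> borel_measurable ?L"
    by (rule measurable_compose[OF _ measurable_ennreal])
  have "(\<integral>\<^sup>+z. ennreal (norm (walsh_poly (\<lambda>(k, \<nu>). subseries (\<Union>l\<in>I. spectrum l) series_coeff k \<nu>) G z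
      - complex_of_real (f z)) * mu l0 z) \<partial>?L) \<le> (\<integral>\<^sup>+z. ennreal (mu l0 z) * ennreal (?R z) + ennreal (norm (?w z)) \<partial>?L)"
  proof (rule nn_integral_mono)
    fix z
    let ?p = "\<Sum>l\<in>I \<inter> {..<m}. piece_poly l z"
    have eq: "walsh_poly (\<lambda>(k, \<nu>). subseries (\<Union>l\<in>I. spectrum l) series_coeff k \<nu>) G z = complex_of_real ?p + ?w z"
      by (rule walsh_poly_subseries[OF G])
    have "norm (complex_of_real ?p + ?w z - complex_of_real (f z)) \<le> norm (complex_of_real (?p - f z)) + norm (?w z)"
      by (rule order.trans[OF _ norm_triangle_ineq]) (simp add: algebra_simps)
    also have "norm (complex_of_real (?p - f z)) = ?R z" by (simp only: norm_of_real abs_minus_commute)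
    finally have "norm (complex_of_real ?p + ?w z - complex_of_real (f z)) * mu l0 z \<le> (?R z + norm (?w z)) * mu l0 z"
      using mu_bounds(1)[of l0 z] by (intro mult_right_mono) auto
    also have "\<dots> = mu l0 z * ?R z + norm (?w z) * mu l0 z" by (simp add: algebra_simps)
    also have "\<dots> \<le> mu l0 z * ?R z + norm (?w z) * 1"
      using mu_bounds(2)[of l0 z] by (intro add_left_mono mult_left_mono) auto
    finally have "ennreal (norm (complex_of_real ?p + ?w z - complex_of_real (f z)) * mu l0 z) \<le> ennreal (mu l0 z * ?R z + norm (?w z))"
      by (intro ennreal_leI) simp
    also have "\<dots> = ennreal (mu l0 z) * ennreal (?R z) + ennreal (norm (?w z))"
      using mu_bounds(1)[of l0 z] by (simp add: ennreal_plus ennreal_mult)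
    finally show "ennreal (norm (walsh_poly (\<lambda>(k, \<nu>). subseries (\<Union>l\<in>I. spectrum l) series_coeff k \<nu>) G z
      - complex_of_real (f z)) * mu l0 z) \<le> ennreal (mu l0 z) * ennreal (?R z) + ennreal (norm (?w z))"
      by (simp only: eq)
  qed
  also have "\<dots> = (\<integral>\<^sup>+z. ennreal (mu l0 z) * ennreal (?R z) \<partial>?L) + (\<integral>\<^sup>+z. ennreal (norm (?w z)) \<partial>?L)"
    using RL wL mu_measurable by (intro nn_integral_add) auto
  also have "(\<integral>\<^sup>+z. ennreal (mu l0 z) * ennreal (?R z) \<partial>?L) = (\<integral>\<^sup>+z. ennreal (?R z) \<partial>weighted_measure l0)"
    using RL by (intro nn_integral_weighted_measure[symmetric]) auto
  also have "\<dots> = ennreal (\<integral>z. ?R z \<partial>weighted_measure l0)"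
    by (rule nn_integral_eq_integral[OF intR]) auto
  also have "(\<integral>\<^sup>+z. ennreal (norm (?w z)) \<partial>?L) \<le> ennreal (partial_bound m)"
    unfolding partial_bound_def by (rule nn_integral_partial_block_le[OF stage_le_offset])
  also have "ennreal (\<integral>z. ?R z \<partial>weighted_measure l0) + ennreal (partial_bound m) =
    ennreal ((\<integral>z. ?R z \<partial>weighted_measure l0) + partial_bound m)"
    by (rule ennreal_plus[symmetric]) (auto simp: partial_bound_def)
  finally show ?thesis by (simp add: add_left_mono)
qed

text \<open>Rectangles and discs are treated together: all that is needed of the sets \<open>G j\<close> is that they
exhaust the blocks in order.\<close>

lemma subseries_converges:
  fixes f :: "real \<times> real \<Rightarrow> real" and G :: "'j \<Rightarrow> (nat \<times> nat) set"
  assumes f: "integrable (weighted_measure l0) f"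
    and I: "(\<lambda>m. \<integral>z. \<bar>f z - (\<Sum>l\<in>I \<inter> {..<m}. piece_poly l z)\<bar> \<partial>weighted_measure l0) \<longlonglongrightarrow> 0"
    and fin: "\<And>j. finite (G j)"
    and mono: "\<And>j h l. h < l \<Longrightarrow> \<not> spectrum h \<subseteq> G j \<Longrightarrow> spectrum l \<inter> G j = {}"
    and exhaust: "\<And>l. \<forall>\<^sub>F j in F. spectrum l \<subseteq> G j"
  shows "L1_converges (mu l0) (\<lambda>j. walsh_poly (\<lambda>(k, \<nu>). subseries (\<Union>l\<in>I. spectrum l) series_coeff k \<nu>) (G j)) f F"
  unfolding L1_converges_def
proof (rule order_tendstoI)
  define e where "e m = (\<integral>z. \<bar>f z - (\<Sum>l\<in>I \<inter> {..<m}. piece_poly l z)\<bar> \<partial>weighted_measure l0) + partial_bound m" for m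
  let ?E = "\<lambda>j. \<integral>\<^sup>+z. ennreal (norm (walsh_poly (\<lambda>(k, \<nu>). subseries (\<Union>l\<in>I. spectrum l) series_coeff k \<nu>) (G j) z
      - complex_of_real (f z)) * mu l0 z) \<partial>lebesgue_on unit_square"
  fix b :: ennreal assume "0 < b"
  then obtain b' where b': "0 < b'" "b' < b" using dense by blast
  then obtain \<delta> where \<delta>: "b' = ennreal \<delta>" "\<delta> > 0"
    by (cases b') auto
  have "e \<longlonglongrightarrow> 0" unfolding e_def using tendsto_add[OF I partial_bound_tendsto] by simp
  then have "\<forall>\<^sub>F m in sequentially. e m < \<delta>" using \<delta>(2) by (rule order_tendstoD)
  then obtain L where L: "\<And>m. m \<ge> L \<Longrightarrow> e m < \<delta>" by (auto simp: eventually_sequentially)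
  have "\<forall>\<^sub>F j in F. \<forall>l\<in>{..<L}. spectrum l \<subseteq> G j"
    using exhaust by (intro eventually_ball_finite) auto
  then show "\<forall>\<^sub>F j in F. ?E j < b"
  proof eventually_elim
    case (elim j)
    \<comment> \<open>The cut is at the first block that is not contained in \<open>G j\<close>; if there were none, any index
      beyond the finitely many blocks that meet \<open>G j\<close> would do.\<close>
    have "\<exists>m\<ge>L. (\<forall>l<m. spectrum l \<subseteq> G j) \<and> (\<forall>l>m. spectrum l \<inter> G j = {})"
    proof (cases "\<exists>l. \<not> spectrum l \<subseteq> G j")
      case True
      define m where "m = (LEAST l. \<not> spectrum l \<subseteq> G j)"
      have m: "\<not> spectrum m \<subseteq> G j" unfolding m_def using True by (rule LeastI_ex)
      have "spectrum l \<subseteq> G j" if "l < m" for l using not_less_Least that unfolding m_def by blast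
      moreover have "m \<ge> L" using m elim by (meson lessThan_iff not_le)
      moreover have "spectrum l \<inter> G j = {}" if "l > m" for l using mono[OF that m] .
      ultimately show ?thesis by blast
    next
      case False
      have "{l. spectrum l \<inter> G j \<noteq> {}} = (\<Union>z\<in>G j. {l. z \<in> spectrum l})" by blast
      moreover have "finite {l. z \<in> spectrum l}" for z
      proof (cases "\<exists>l. z \<in> spectrum l")
        case True
        then obtain l where "z \<in> spectrum l" by blast
        then have "{l. z \<in> spectrum l} \<subseteq> {l}" using spectrum_disjoint by blast
        then show ?thesis by (rule finite_subset) simp
      qed simp
      ultimately have "finite {l. spectrum l \<inter> G j \<noteq> {}}" using fin by simp
      then obtain n where "{l. spectrum l \<inter> G j \<noteq> {}} \<subseteq> {..<n}" using finite_nat_iff_bounded by blast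
      then have "spectrum l \<inter> G j = {}" if "l > max L n" for l using that by fastforce
      with False show ?thesis by (intro exI[of _ "max L n"]) auto
    qed
    then obtain m where m: "m \<ge> L" "\<And>l. l < m \<Longrightarrow> spectrum l \<subseteq> G j" "\<And>l. l > m \<Longrightarrow> spectrum l \<inter> G j = {}"
      by blast
    have "?E j \<le> ennreal (e m)"
      unfolding e_def by (rule nn_integral_subseries_error[OF f fin m(2,3)])
    also have "\<dots> \<le> ennreal \<delta>" using L[OF m(1)] by (intro ennreal_leI) simp
    finally show ?case using b' \<delta>(1) by simp
  qed
qed simp

lemma sph_index_spectrum_mono:
  assumes "h < l" "\<not> spectrum h \<subseteq> sph_index R"
  shows "spectrum l \<inter> sph_index R = {}"
proof -
  obtain k \<nu> where k: "(k, \<nu>) \<in> spectrum h" "(k, \<nu>) \<notin> sph_index R" using assms(2) by auto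
  then have "k \<ge> 1" "\<nu> \<ge> 1" using spectrum_ge_1 by blast+
  with k have R: "(real k)\<^sup>2 + (real \<nu>)\<^sup>2 > R\<^sup>2" by (auto simp: sph_index_def)
  have "(k', \<nu>') \<notin> sph_index R" if "(k', \<nu>') \<in> spectrum l" for k' \<nu>'
  proof -
    have "(real k)\<^sup>2 \<le> (real k')\<^sup>2" "(real \<nu>)\<^sup>2 \<le> (real \<nu>')\<^sup>2"
      using spectrum_bounds[OF k(1) that assms(1)] by (auto intro!: power_mono)
    with R have "\<not> (real k')\<^sup>2 + (real \<nu>')\<^sup>2 \<le> R\<^sup>2" by linarith
    then show ?thesis by (simp add: sph_index_def)
  qed
  then show ?thesis by auto
qed

lemma sph_index_exhausts: "\<forall>\<^sub>F R in at_top. spectrum l \<subseteq> sph_index R"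
proof -
  define n where "n = a ^ (offset l + 3 * stage l)"
  have "spectrum l \<subseteq> sph_index R" if "R \<ge> 2 * real n" for R
  proof safe
    fix k \<nu> assume kn: "(k, \<nu>) \<in> spectrum l"
    have "(real k)\<^sup>2 \<le> (real n)\<^sup>2" "(real \<nu>)\<^sup>2 \<le> (real n)\<^sup>2"
      using kn by (auto simp: frequencies_def n_def intro!: power_mono simp flip: of_nat_power)
    moreover have "(2 * real n)\<^sup>2 \<le> R\<^sup>2" using that by (intro power_mono) auto
    moreover have "(2 * real n)\<^sup>2 = 4 * (real n)\<^sup>2" "0 \<le> (real n)\<^sup>2" by (simp_all add: power2_eq_square)
    ultimately have "(real k)\<^sup>2 + (real \<nu>)\<^sup>2 \<le> R\<^sup>2" by linarith
    then show "(k, \<nu>) \<in> sph_index R" using spectrum_ge_1 kn by (fastforce simp: sph_index_def)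
  qed
  then show ?thesis by (auto simp: eventually_at_top_linorder)
qed

lemma rectangle_spectrum_mono:
  assumes "h < l" "\<not> spectrum h \<subseteq> {1..n} \<times> {1..m}"
  shows "spectrum l \<inter> {1..n} \<times> {1..m} = {}"
proof -
  obtain k \<nu> where k: "(k, \<nu>) \<in> spectrum h" "(k, \<nu>) \<notin> {1..n} \<times> {1..m}"
    using assms(2) by (metis subrelI)
  then have "k \<ge> 1" "\<nu> \<ge> 1" using spectrum_ge_1 by blast+
  with k have *: "k > n \<or> \<nu> > m" by auto
  have "(k', \<nu>') \<notin> {1..n} \<times> {1..m}" if "(k', \<nu>') \<in> spectrum l" for k' \<nu>'
    using * spectrum_bounds[OF k(1) that assms(1)] by auto
  then show ?thesis by auto
qed

lemma rectangle_exhausts: "\<forall>\<^sub>F j in sequentially \<times>\<^sub>F sequentially. spectrum l \<subseteq> {1..fst j} \<times> {1..snd j}"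
proof -
  define N where "N = a ^ (offset l + 3 * stage l)"
  have "spectrum l \<subseteq> {1..n} \<times> {1..m}" if "n \<ge> N" "m \<ge> N" for n m
    using spectrum_ge_1[of l] that by (fastforce simp: frequencies_def N_def)
  then show ?thesis by (auto simp: eventually_prod_sequentially)
qed

lemma universal_weighted: "universal_subseries a (mu l0) series_coeff"
  unfolding universal_subseries_def
proof
  let ?M = "weighted_measure l0"
  fix f assume "f \<in> L1_space (mu l0)"
  then have fL: "f \<in> borel_measurable (lebesgue_on unit_square)"
    and fin: "(\<integral>\<^sup>+z. ennreal (\<bar>f z\<bar> * mu l0 z) \<partial>lebesgue_on unit_square) < \<infinity>"
    by (auto simp: L1_space_def)
  have f: "integrable ?M f"
  proof (rule integrableI_bounded)
    show "f \<in> borel_measurable ?M" using fL measurable_cong_sets[OF sets_weighted_measure refl] by blast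
    have "(\<integral>\<^sup>+z. ennreal (norm (f z)) \<partial>?M) = (\<integral>\<^sup>+z. ennreal (mu l0 z) * ennreal (norm (f z)) \<partial>lebesgue_on unit_square)"
      using fL by (intro nn_integral_weighted_measure) auto
    also have "\<dots> = (\<integral>\<^sup>+z. ennreal (\<bar>f z\<bar> * mu l0 z) \<partial>lebesgue_on unit_square)"
      using mu_bounds(1) by (intro nn_integral_cong) (simp add: ennreal_mult less_imp_le mult.commute)
    finally show "(\<integral>\<^sup>+z. ennreal (norm (f z)) \<partial>?M) < \<infinity>" using fin by simp
  qed
  obtain I where I: "(\<lambda>m. \<integral>z. \<bar>f z - (\<Sum>l\<in>I \<inter> {..<m}. piece_poly l z)\<bar> \<partial>?M) \<longlonglongrightarrow> 0"
    using greedy_selection[OF integrable_piece_poly weighted_approximation f] by blast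
  let ?A = "\<Union>l\<in>I. spectrum l"
  have "?A \<subseteq> {1..} \<times> {1..}" using spectrum_ge_1 by blast
  moreover have "L1_converges (mu l0) (sph_sum a (subseries ?A series_coeff)) f at_top"
    using subseries_converges[OF f I finite_sph_index sph_index_spectrum_mono sph_index_exhausts]
    unfolding sph_sum_eq_walsh_poly[abs_def] .
  moreover have "L1_converges (mu l0) (rect_sum a (subseries ?A series_coeff)) f (sequentially \<times>\<^sub>F sequentially)"
  proof -
    have "L1_converges (mu l0) (\<lambda>j. walsh_poly (\<lambda>(k, \<nu>). subseries ?A series_coeff k \<nu>) ({1..fst j} \<times> {1..snd j})) f (sequentially \<times>\<^sub>F sequentially)"
      by (rule subseries_converges[OF f I _ rectangle_spectrum_mono rectangle_exhausts]) auto
    then show ?thesis unfolding rect_sum_eq_walsh_poly split_beta .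
  qed
  ultimately show "\<exists>A\<subseteq>{1..} \<times> {1..}. L1_converges (mu l0) (sph_sum a (subseries A series_coeff)) f at_top \<and>
      L1_converges (mu l0) (rect_sum a (subseries A series_coeff)) f (sequentially \<times>\<^sub>F sequentially)"
    by blast
qed

lemma measure_mu_neq_1:
  assumes "\<epsilon> > 0"
  shows "\<exists>l0. measure lebesgue {z \<in> unit_square. mu l0 z \<noteq> 1} < \<epsilon>"
proof -
  let ?L = "lebesgue_on unit_square"
  interpret finite_measure ?L by (rule finite_measure_unit_square)
  define b where "b l = measure ?L (piece_bad l)" for l
  have b: "summable b" unfolding b_def by (rule summable_bad_sets)
  obtain l0 where "\<forall>n\<ge>l0. norm (\<Sum>l. b (l + n)) < \<epsilon>"
    using suminf_exist_split[OF assms b] by (elim exE)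
  then have "norm (\<Sum>l. b (l + l0)) < \<epsilon>" by (simp only: order_refl)
  then have l0: "(\<Sum>l. b (l + l0)) < \<epsilon>" unfolding real_norm_def by linarith
  have sum: "summable (\<lambda>l. b (l + l0))"
    using b by (rule summable_ignore_initial_segment)
  have sub: "{z \<in> unit_square. mu l0 z \<noteq> 1} \<subseteq> (\<Union>l. piece_bad (l + l0))"
  proof
    fix z assume "z \<in> {z \<in> unit_square. mu l0 z \<noteq> 1}"
    then have "mu l0 z \<noteq> 1" by simp
    then obtain i where "i \<ge> l0" "z \<in> piece_bad i"
      unfolding mu_def by (elim weight_neq_1[THEN exE]) blast
    then show "z \<in> (\<Union>l. piece_bad (l + l0))" by (intro UN_I[of "i - l0"]) simp_all
  qed
  have "measure lebesgue {z \<in> unit_square. mu l0 z \<noteq> 1} = measure ?L {z \<in> unit_square. mu l0 z \<noteq> 1}"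
    using unit_square_sets by (intro measure_restrict_space[symmetric]) auto
  also have "\<dots> \<le> measure ?L (\<Union>l. piece_bad (l + l0))"
    using sub by (rule finite_measure_mono) (intro sets.countable_UN image_subsetI piece_bad_sets)
  also have "\<dots> \<le> (\<Sum>l. b (l + l0))"
    using finite_measure_subadditive_countably[of "\<lambda>l. piece_bad (l + l0)"] sum piece_bad_sets
    unfolding b_def by blast
  finally show ?thesis using l0 by (intro exI[of _ l0]) simp
qed

end

theorem theorem3p1:
  fixes a :: nat
  assumes "a \<ge> 2"
  shows "\<exists>c :: nat \<Rightarrow> nat \<Rightarrow> complex.
    (\<forall>q::real. q > 2 \<longrightarrow> (\<lambda>(n, k). norm (c n k) powr q) summable_on {1..} \<times> {1..}) \<and>
    (\<forall>\<epsilon>::real. \<epsilon> > 0 \<longrightarrow>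
      (\<exists>\<mu> :: real \<times> real \<Rightarrow> real.
        \<mu> \<in> borel_measurable (lebesgue_on unit_square) \<and>
        (\<forall>z\<in>unit_square. 0 < \<mu> z \<and> \<mu> z \<le> 1) \<and>
        measure lebesgue {z \<in> unit_square. \<mu> z \<noteq> 1} < \<epsilon> \<and>
        universal_subseries a \<mu> c))"
proof -
  interpret adic_base a by unfold_locales (rule assms)
  show ?thesis
  proof (intro exI[of _ series_coeff] conjI allI impI)
    show "(\<lambda>(n, k). norm (series_coeff n k) powr q) summable_on {1..} \<times> {1..}" if "q > 2" for q
      using that by (rule series_coeff_summable)
    fix \<epsilon> :: real assume "\<epsilon> > 0"
    obtain l0 where l0: "measure lebesgue {z \<in> unit_square. mu l0 z \<noteq> 1} < \<epsilon>"
      using measure_mu_neq_1[OF \<open>\<epsilon> > 0\<close>] by (elim exE)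
    show "\<exists>\<mu> :: real \<times> real \<Rightarrow> real.
        \<mu> \<in> borel_measurable (lebesgue_on unit_square) \<and>
        (\<forall>z\<in>unit_square. 0 < \<mu> z \<and> \<mu> z \<le> 1) \<and>
        measure lebesgue {z \<in> unit_square. \<mu> z \<noteq> 1} < \<epsilon> \<and>
        universal_subseries a \<mu> series_coeff"
    proof (intro exI[of _ "mu l0"] conjI ballI)
      show "mu l0 \<in> borel_measurable (lebesgue_on unit_square)" by (rule mu_measurable)
      show "0 < mu l0 z" "mu l0 z \<le> 1" for z by (rule mu_bounds)+
      show "measure lebesgue {z \<in> unit_square. mu l0 z \<noteq> 1} < \<epsilon>" by (rule l0)
      show "universal_subseries a (mu l0) series_coeff" by (rule universal_weighted)
    qed
  qed
qed

end
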